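(* Let $\mu>0$, $\mathbf{y}\in\{-1,1\}^n$, $\mathbf{w},\mathbf{x}_1,\dots,\mathbf{x}_n\in\mathbb{R}^p$, and set $a_i=\frac{-2}{n}y_i\langle\mathbf{w},\mathbf{x}_i\rangle$. Consider the problem $$\min_{\boldsymbol\theta\in\mathbb{R}^n}\left\{\max_{\mathbf{z}\in\{-1,1\}^n}\Big[\Delta(\mathbf{z},\mathbf{y})+\sum_{i=1}^n\theta_i\,\delta(z_i=-y_i)\Big]+\sum_{i=1}^n\max_{\beta_i\in[0,1]}\Big[\frac{-\mu}{2}\beta_i^2-\Big(\frac2n y_i\langle\mathbf{w},\mathbf{x}_i\rangle+\theta_i\Big)\beta_i\Big]\right\}.$$ There must exist a unique optimal solution $\boldsymbol\theta^*$ of this problem. Furthermore, $\theta_i^*\in[a_i-\mu,a_i]$ for all $i$, and $\boldsymbol\theta^*$ can be computed in $O(n\log n)$ time when $\Delta$ is the PRBEP discrepancy.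
   Context: $\delta(\cdot)$ equals $1$ if its argument is true and $0$ otherwise. $\Delta(\mathbf{z},\mathbf{y})\in\mathbb{R}\cup\{-\infty\}$ is the multivariate discrepancy between the correct labels $\mathbf{y}$ and a candidate labeling $\mathbf{z}$ associated with a contingency table based performance measure (finite for at least one $\mathbf{z}$). The PRBEP (precision/recall break-even point) discrepancy is: with $n_+=|\{i:y_i=1\}|$, $b=|\{i:y_i=1,\ z_i=-1\}|$, $c=|\{j:y_j=-1,\ z_j=1\}|$, $\Delta(\mathbf{z},\mathbf{y})=b/n_+$ if $b=c$ and $-\infty$ otherwise.
   Formalization: The optimal solution need not be unique over all of R^n; what is proved is that exactly one optimal solution has θ_i in [a_i−μ, a_i] for all i, and that clipping any optimal solution to these intervals gives an optimal solution. The O(n log n) algorithm takes n, μ, a_i and y as input. *)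

theory Defs
  imports
    Complex_Main
    "HOL-Library.Extended_Real"
    "HOL-Library.Landau_Symbols"
    "Jordan_Normal_Form.Matrix"
begin

section \<open>Labelings and discrepancies\<close>

definition labelings :: "nat \<Rightarrow> real vec set" where
  "labelings n = {z \<in> carrier_vec n. \<forall>i<n. z $ i \<in> {-1, 1}}"

definition true_pos :: "real vec \<Rightarrow> real vec \<Rightarrow> nat" where
  "true_pos z y = card {i. i < dim_vec y \<and> y $ i = 1 \<and> z $ i = 1}"

definition false_neg :: "real vec \<Rightarrow> real vec \<Rightarrow> nat" where
  "false_neg z y = card {i. i < dim_vec y \<and> y $ i = 1 \<and> z $ i = -1}"

definition false_pos :: "real vec \<Rightarrow> real vec \<Rightarrow> nat" where
  "false_pos z y = card {i. i < dim_vec y \<and> y $ i = -1 \<and> z $ i = 1}"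

definition true_neg :: "real vec \<Rightarrow> real vec \<Rightarrow> nat" where
  "true_neg z y = card {i. i < dim_vec y \<and> y $ i = -1 \<and> z $ i = -1}"

text \<open>A discrepancy with values in the reals and minus infinity, determined by the contingency
  table of the candidate labeling against the correct labels \<open>y\<close>.\<close>

definition is_discrepancy ::
    "nat \<Rightarrow> real vec \<Rightarrow> (real vec \<Rightarrow> real vec \<Rightarrow> ereal) \<Rightarrow> bool" where
  "is_discrepancy n y \<Delta> \<longleftrightarrow>
     (\<exists>\<psi>. \<forall>z\<in>labelings n.
        \<Delta> z y = \<psi> (true_pos z y) (false_neg z y) (false_pos z y) (true_neg z y)) \<and>
     (\<forall>z\<in>labelings n. \<Delta> z y \<noteq> \<infinity>) \<and>
     (\<exists>z\<in>labelings n. \<Delta> z y \<noteq> -\<infinity>)"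

text \<open>If no label is positive, the quotient is \<open>0 / 0 = 0\<close>; the only
  labeling with finite discrepancy is then \<open>z = y\<close>, with discrepancy 0.\<close>

definition prbep :: "real vec \<Rightarrow> real vec \<Rightarrow> ereal" where
  "prbep z y =
     (let npos = card {i. i < dim_vec y \<and> y $ i = 1} in
      if false_neg z y = false_pos z y then ereal (real (false_neg z y) / real npos) else -\<infinity>)"


section \<open>The optimization problem\<close>

definition coeff_a :: "nat \<Rightarrow> real vec \<Rightarrow> real vec \<Rightarrow> (nat \<Rightarrow> real vec) \<Rightarrow> nat \<Rightarrow> real" where
  "coeff_a n y w x i = (-2 / real n) * (y $ i) * (w \<bullet> x i)"

text \<open>The supremum over \<open>\<beta>\<close> is the maximum of a continuous function on a compact interval.\<close>

definition objective ::
    "nat \<Rightarrow> real \<Rightarrow> (real vec \<Rightarrow> real vec \<Rightarrow> ereal) \<Rightarrow> real vec \<Rightarrow> real vec \<Rightarrow> (nat \<Rightarrow> real vec)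
      \<Rightarrow> real vec \<Rightarrow> ereal" where
  "objective n \<mu> \<Delta> y w x \<theta> =
     Max ((\<lambda>z. \<Delta> z y + ereal (\<Sum>i<n. \<theta> $ i * of_bool (z $ i = - (y $ i)))) ` labelings n) +
     ereal (\<Sum>i<n. SUP \<beta>\<in>{0..1::real}.
        (-\<mu> / 2) * \<beta>\<^sup>2 - ((2 / real n) * (y $ i) * (w \<bullet> x i) + \<theta> $ i) * \<beta>)"

definition optimal ::
    "nat \<Rightarrow> real \<Rightarrow> (real vec \<Rightarrow> real vec \<Rightarrow> ereal) \<Rightarrow> real vec \<Rightarrow> real vec \<Rightarrow> (nat \<Rightarrow> real vec)
      \<Rightarrow> real vec \<Rightarrow> bool" where
  "optimal n \<mu> \<Delta> y w x = is_arg_min (objective n \<mu> \<Delta> y w x) (\<lambda>\<theta>. \<theta> \<in> carrier_vec n)"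

text \<open>The part of the objective that is separable in \<open>\<theta>\<close> is strictly convex on the box
  \<open>a\<^sub>i - \<mu> \<le> \<theta>\<^sub>i \<le> a\<^sub>i\<close> but affine on either side of it, so that optimal solutions outside the box
  need not be unique: for \<open>n = 2\<close>, \<open>y = (1, -1)\<close>, PRBEP and \<open>a = (-10, -10)\<close>, every
  \<open>\<theta> = (t, t)\<close> with \<open>-10 \<le> t \<le> -1/2\<close> is optimal. Clipping to the box identifies them.\<close>

definition in_box :: "nat \<Rightarrow> (nat \<Rightarrow> real) \<Rightarrow> real \<Rightarrow> real vec \<Rightarrow> bool" where
  "in_box n a \<mu> \<theta> \<longleftrightarrow> (\<forall>i<n. \<theta> $ i \<in> {a i - \<mu>..a i})"

definition clip :: "nat \<Rightarrow> (nat \<Rightarrow> real) \<Rightarrow> real \<Rightarrow> real vec \<Rightarrow> real vec" where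
  "clip n a \<mu> \<theta> = vec n (\<lambda>i. max (a i - \<mu>) (min (a i) (\<theta> $ i)))"


section \<open>A real random access machine\<close>

text \<open>Structured programs for the unit-cost real RAM: integer registers for counting and addressing
  (constants, addition, truncated subtraction, comparison only), real registers with exact field
  arithmetic and comparison, and one array of reals addressed indirectly through integer registers.
  There is no conversion from reals to integers, and division by zero gets stuck. The numeric argument of \<open>exec\<close>
  counts executed instructions and evaluated tests.\<close>

record ram =
  ireg :: "nat \<Rightarrow> nat"
  rreg :: "nat \<Rightarrow> real"
  mem  :: "nat \<Rightarrow> real"

datatype test = ILess nat nat | RLess nat nat

datatype prog =
    ISet nat nat
  | IAdd nat nat nat
  | ISub nat nat nat
  | RSet nat nat
  | RAdd nat nat nat
  | RSub nat nat nat
  | RMul nat nat nat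
  | RDiv nat nat nat
  | Load nat nat
  | Store nat nat
  | Seq prog prog
  | Cond test prog prog
  | While test prog

fun holds :: "test \<Rightarrow> ram \<Rightarrow> bool" where
  "holds (ILess u v) s \<longleftrightarrow> ireg s u < ireg s v"
| "holds (RLess u v) s \<longleftrightarrow> rreg s u < rreg s v"

inductive exec :: "prog \<Rightarrow> ram \<Rightarrow> nat \<Rightarrow> ram \<Rightarrow> bool" where
  ISet: "exec (ISet d k) s 1 (s\<lparr>ireg := (ireg s)(d := k)\<rparr>)"
| IAdd: "exec (IAdd d u v) s 1 (s\<lparr>ireg := (ireg s)(d := ireg s u + ireg s v)\<rparr>)"
| ISub: "exec (ISub d u v) s 1 (s\<lparr>ireg := (ireg s)(d := ireg s u - ireg s v)\<rparr>)"
| RSet: "exec (RSet d k) s 1 (s\<lparr>rreg := (rreg s)(d := real k)\<rparr>)"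
| RAdd: "exec (RAdd d u v) s 1 (s\<lparr>rreg := (rreg s)(d := rreg s u + rreg s v)\<rparr>)"
| RSub: "exec (RSub d u v) s 1 (s\<lparr>rreg := (rreg s)(d := rreg s u - rreg s v)\<rparr>)"
| RMul: "exec (RMul d u v) s 1 (s\<lparr>rreg := (rreg s)(d := rreg s u * rreg s v)\<rparr>)"
| RDiv: "rreg s v \<noteq> 0 \<Longrightarrow>
    exec (RDiv d u v) s 1 (s\<lparr>rreg := (rreg s)(d := rreg s u / rreg s v)\<rparr>)"
| Load: "exec (Load d u) s 1 (s\<lparr>rreg := (rreg s)(d := mem s (ireg s u))\<rparr>)"
| Store: "exec (Store u v) s 1 (s\<lparr>mem := (mem s)(ireg s u := rreg s v)\<rparr>)"
| Seq: "exec c s t s' \<Longrightarrow> exec c' s' t' s'' \<Longrightarrow> exec (Seq c c') s (t + t') s''"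
| CondTrue: "holds b s \<Longrightarrow> exec c s t s' \<Longrightarrow> exec (Cond b c c') s (1 + t) s'"
| CondFalse: "\<not> holds b s \<Longrightarrow> exec c' s t s' \<Longrightarrow> exec (Cond b c c') s (1 + t) s'"
| WhileTrue: "holds b s \<Longrightarrow> exec c s t s' \<Longrightarrow> exec (While b c) s' t' s'' \<Longrightarrow>
    exec (While b c) s (1 + t + t') s''"
| WhileFalse: "\<not> holds b s \<Longrightarrow> exec (While b c) s 1 s"

text \<open>The input consists of \<open>n\<close>, \<open>\<mu>\<close>, the coefficients \<open>a\<^sub>i\<close> (cells \<open>0,\<dots>,n-1\<close>) and the labels
  \<open>y\<^sub>i\<close> (cells \<open>n,\<dots>,2n-1\<close>); the solution replaces the coefficients.\<close>

definition input_state :: "nat \<Rightarrow> real \<Rightarrow> (nat \<Rightarrow> real) \<Rightarrow> real vec \<Rightarrow> ram" where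
  "input_state n \<mu> a y =
     \<lparr>ireg = (\<lambda>_. 0)(0 := n),
      rreg = (\<lambda>_. 0)(0 := \<mu>),
      mem = (\<lambda>k. if k < n then a k else if k < 2 * n then y $ (k - n) else 0)\<rparr>"

definition output_vec :: "nat \<Rightarrow> ram \<Rightarrow> real vec" where
  "output_vec n s = vec n (mem s)"

end

theory Submission
  imports "HOL-Analysis.Function_Topology" Defs "HOL-Combinatorics.Permutations"
begin

text \<open>The maximum over the labelings is convex in \<open>\<theta>\<close> and grows at most at unit rate in each
  coordinate, while the separable part falls at unit rate below the box, is constant above it and is
  strictly convex inside. So clipping to the box never increases the objective, a minimizer exists
  by compactness of the box, and it is unique there.

  For PRBEP, the dual problem maximizes over \<open>\<beta>\<close> in the unit cube subject to one linear constraint, that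
  \<open>\<beta>\<close> has the same mass on positive and on negative labels. With its multiplier \<open>\<nu>\<close>, the minimizer is the
  point \<open>(\<nu> - 1/n\<^sub>+, -\<nu>)\<close> clipped to the box, and \<open>\<nu>\<close> solves a piecewise linear equation
  \<open>\<Sum>\<^sub>i min \<mu> (max 0 (\<nu> - s\<^sub>i)) = \<mu> n\<^sub>+\<close> whose breakpoints are \<open>s\<^sub>i\<close> and \<open>s\<^sub>i + \<mu>\<close>. After sorting the \<open>s\<^sub>i\<close>,
  two pointers merge both lists of breakpoints and find the root in linear time.\<close>

section \<open>The loss of a single coordinate\<close>

text \<open>That \<beta> may range over the whole cube rests on a rounding argument. On balanced
  labelings the PRBEP discrepancy is linear in the indicator of the flipped labels, so the maximum
  over labelings is a linear program over 0-1 vectors. Its single constraint has coefficients 1 and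
  -1, and an exchange argument shows that fractional points gain nothing. Every balanced \<beta>
  thus bounds the objective from below at all \<theta>, and one \<theta> that attains such a bound
  is optimal.

  The breakpoints come from the balance of a clipped point: label times
  \<open>a i - \<theta> i\<close> is \<mu> for a positive label and 0 for a negative one, minus a
  ramp of width \<mu> that starts at the shift. All ramps rise with \<nu>, and the target lies
  between 0 and \<mu> times \<open>n\<close>, so a root exists.

  The machine can neither halve an integer nor convert between integers and reals. Hence the heap is
  only traversed downwards, with children reached by doubling, and counts that enter real arithmetic
  live in real registers. The logarithm occurs in the analysis alone, through an exponent
  \<open>e\<close> with \<open>n < 2 ^ e\<close>.\<close>

definition clamp01 :: "real \<Rightarrow> real" where
  "clamp01 u = max 0 (min 1 u)"

text \<open>A one-sided Huber function, the conjugate of \<mu>/2 \<beta>^2 on the unit interval: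
  zero up to 0, quadratic up to \<mu>, then of slope 1. Writing it through its maximizer makes
  continuity immediate.\<close>

definition hub :: "real \<Rightarrow> real \<Rightarrow> real" where
  "hub \<mu> u = (- \<mu> / 2) * (clamp01 (u / \<mu>))\<^sup>2 + u * clamp01 (u / \<mu>)"

lemma clamp01_bounds: "0 \<le> clamp01 u" "clamp01 u \<le> 1"
  by (auto simp: clamp01_def)

text \<open>Completing the square at the maximizer \<open>b\<close> leaves a product that is
  nonnegative because \<open>b\<close> is the projection of \<open>u / \<mu>\<close> onto the unit
  interval.\<close>

lemma hub_upper:
  assumes "\<mu> > 0" "0 \<le> \<beta>" "\<beta> \<le> 1"
  shows "(- \<mu> / 2) * \<beta>\<^sup>2 + u * \<beta> \<le> hub \<mu> u"
proof -
  define b where "b = clamp01 (u / \<mu>)"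
  have "hub \<mu> u - ((- \<mu> / 2) * \<beta>\<^sup>2 + u * \<beta>)
      = \<mu> / 2 * (b - \<beta>)\<^sup>2 + \<mu> * (u / \<mu> - b) * (b - \<beta>)"
    using assms by (simp add: hub_def b_def [symmetric] power2_eq_square field_simps)
  moreover have "(u / \<mu> - b) * (b - \<beta>) \<ge> 0"
  proof -
    consider "u / \<mu> < 0" | "0 \<le> u / \<mu>" "u / \<mu> \<le> 1" | "1 < u / \<mu>" by linarith
    then show ?thesis
    proof cases
      case 1
      then have "b = 0" by (simp add: b_def clamp01_def)
      then have "(u / \<mu> - b) * (b - \<beta>) = (- (u / \<mu>)) * \<beta>" by simp
      then show ?thesis using 1 assms by (metis less_eq_real_def mult_nonneg_nonneg neg_0_le_iff_le)
    next
      case 2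
      then have "b = u / \<mu>" by (simp add: b_def clamp01_def)
      then show ?thesis by simp
    next
      case 3
      then have "b = 1" by (simp add: b_def clamp01_def)
      then show ?thesis using 3 assms by simp
    qed
  qed
  then have "\<mu> * (u / \<mu> - b) * (b - \<beta>) \<ge> 0"
    using assms by (metis less_eq_real_def mult.assoc mult_nonneg_nonneg)
  ultimately show ?thesis
    using assms by (smt (verit) divide_nonneg_nonneg mult_nonneg_nonneg zero_le_power2)
qed

lemma SUP_eq_hub:
  assumes "\<mu> > 0"
  shows "(SUP \<beta>\<in>{0..1::real}. (- \<mu> / 2) * \<beta>\<^sup>2 + u * \<beta>) = hub \<mu> u"
proof (rule cSup_eq_maximum)
  show "hub \<mu> u \<in> (\<lambda>\<beta>. (- \<mu> / 2) * \<beta>\<^sup>2 + u * \<beta>) ` {0..1}"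
    by (rule image_eqI [where x = "clamp01 (u / \<mu>)"]) (auto simp: hub_def clamp01_bounds)
qed (use hub_upper [OF assms] in auto)

lemma continuous_hub: "\<mu> > 0 \<Longrightarrow> continuous_on UNIV (hub \<mu>)"
  unfolding hub_def [abs_def] clamp01_def by (intro continuous_intros) auto

lemma hub_nonpos: "\<mu> > 0 \<Longrightarrow> u \<le> 0 \<Longrightarrow> hub \<mu> u = 0"
  by (simp add: hub_def clamp01_def divide_nonpos_pos min_absorb2 max_absorb1)

lemma hub_mid:
  assumes "\<mu> > 0" "0 \<le> u" "u \<le> \<mu>"
  shows "hub \<mu> u = u\<^sup>2 / (2 * \<mu>)"
proof -
  have "clamp01 (u / \<mu>) = u / \<mu>"
    using assms by (simp add: clamp01_def min_def max_def)
  then show ?thesis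
    using assms by (simp add: hub_def power2_eq_square field_simps)
qed

lemma hub_ge:
  assumes "\<mu> > 0" "\<mu> \<le> u"
  shows "hub \<mu> u = u - \<mu> / 2"
proof -
  have "clamp01 (u / \<mu>) = 1"
    using assms by (simp add: clamp01_def min_def max_def)
  then show ?thesis
    by (simp add: hub_def)
qed

text \<open>Between 0 and \<mu> the loss is a parabola, so its convexity defect is known exactly.
  This defect is what forces uniqueness in the box.\<close>

lemma hub_midpoint:
  assumes "\<mu> > 0" "u \<in> {0..\<mu>}" "v \<in> {0..\<mu>}"
  shows "hub \<mu> ((u + v) / 2) = (hub \<mu> u + hub \<mu> v) / 2 - (u - v)\<^sup>2 / (8 * \<mu>)"
  using assms by (simp add: hub_mid power2_eq_square field_simps)

text \<open>The summand \<open>max 0 ...\<close> is the most by which clipping this coordinate can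
  raise the maximum over labelings. Below the box the unit slope of \<open>hub\<close> pays for it
  exactly; above the box there is nothing to pay.\<close>

lemma hub_clip:
  fixes a t :: real
  assumes "\<mu> > 0"
  shows "hub \<mu> (a - max (a - \<mu>) (min a t)) + max 0 (max (a - \<mu>) (min a t) - t) \<le> hub \<mu> (a - t)"
proof -
  consider "t > a" | "a - \<mu> \<le> t" "t \<le> a" | "t < a - \<mu>" by linarith
  then show ?thesis
  proof cases
    case 1
    then show ?thesis using assms by (simp add: hub_nonpos max_def min_def)
  next
    case 2
    then show ?thesis by (simp add: max_def min_def)
  next
    case 3
    then show ?thesis using assms by (simp add: hub_ge max_def min_def)
  qed
qed


section \<open>The objective as a real function\<close>

lemma finite_labelings: "finite (labelings n)"
proof (rule finite_subset)
  show "labelings n \<subseteq> (\<lambda>f. vec n f) ` (PiE {..<n} (\<lambda>_. {-1, 1}))"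
  proof
    fix z assume z: "z \<in> labelings n"
    show "z \<in> (\<lambda>f. vec n f) ` (PiE {..<n} (\<lambda>_. {-1, 1}))"
    proof
      show "z = vec n (restrict (($) z) {..<n})"
        using z by (intro eq_vecI) (auto simp: labelings_def)
      show "restrict (($) z) {..<n} \<in> PiE {..<n} (\<lambda>_. {-1, 1})"
        using z by (auto simp: labelings_def)
    qed
  qed
  show "finite ((\<lambda>f. vec n f) ` (PiE {..<n} (\<lambda>_. {-1::real, 1})))"
    by (intro finite_imageI finite_PiE) auto
qed

text \<open>Labelings of value -\<infinity> never decide the maximum; without them it is a maximum
  of reals.\<close>

definition finite_labelings_of ::
    "nat \<Rightarrow> (real vec \<Rightarrow> real vec \<Rightarrow> ereal) \<Rightarrow> real vec \<Rightarrow> real vec set" where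
  "finite_labelings_of n \<Delta> y = {z \<in> labelings n. \<Delta> z y \<noteq> -\<infinity>}"

definition label_gain ::
    "nat \<Rightarrow> (real vec \<Rightarrow> real vec \<Rightarrow> ereal) \<Rightarrow> real vec \<Rightarrow> (nat \<Rightarrow> real) \<Rightarrow> real vec \<Rightarrow> real" where
  "label_gain n \<Delta> y f z = real_of_ereal (\<Delta> z y) + (\<Sum>i<n. f i * of_bool (z $ i = - (y $ i)))"

definition max_gain ::
    "nat \<Rightarrow> (real vec \<Rightarrow> real vec \<Rightarrow> ereal) \<Rightarrow> real vec \<Rightarrow> (nat \<Rightarrow> real) \<Rightarrow> real" where
  "max_gain n \<Delta> y f = Max (label_gain n \<Delta> y f ` finite_labelings_of n \<Delta> y)"

text \<open>The argument is a function on all naturals instead of a vector, so that continuity and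
  compactness come from the product topology.\<close>

definition real_objective ::
    "nat \<Rightarrow> real \<Rightarrow> (real vec \<Rightarrow> real vec \<Rightarrow> ereal) \<Rightarrow> real vec \<Rightarrow> (nat \<Rightarrow> real) \<Rightarrow> (nat \<Rightarrow> real)
      \<Rightarrow> real" where
  "real_objective n \<mu> \<Delta> y a f = max_gain n \<Delta> y f + (\<Sum>i<n. hub \<mu> (a i - f i))"

locale finite_discrepancy =
  fixes n :: nat and \<mu> :: real and \<Delta> :: "real vec \<Rightarrow> real vec \<Rightarrow> ereal" and y :: "real vec"
  assumes mu: "\<mu> > 0"
    and not_inf: "\<And>z. z \<in> labelings n \<Longrightarrow> \<Delta> z y \<noteq> \<infinity>"
    and ex_finite: "\<exists>z\<in>labelings n. \<Delta> z y \<noteq> -\<infinity>"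
begin

abbreviation "Z \<equiv> finite_labelings_of n \<Delta> y"

lemma finite_Z: "finite Z" and Z_nonempty: "Z \<noteq> {}"
  using finite_labelings ex_finite by (auto simp: finite_labelings_of_def)

lemma max_gain_attained: "\<exists>z\<in>Z. max_gain n \<Delta> y f = label_gain n \<Delta> y f z"
proof -
  have "max_gain n \<Delta> y f \<in> label_gain n \<Delta> y f ` Z"
    unfolding max_gain_def using finite_Z Z_nonempty by (intro Max_in) auto
  then show ?thesis by auto
qed

lemma label_gain_le_max: "z \<in> Z \<Longrightarrow> label_gain n \<Delta> y f z \<le> max_gain n \<Delta> y f"
  unfolding max_gain_def using finite_Z by auto

lemma objective_eq:
  "objective n \<mu> \<Delta> y w x \<theta> = ereal (real_objective n \<mu> \<Delta> y (coeff_a n y w x) (($) \<theta>))"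
proof -
  let ?g = "\<lambda>z. \<Delta> z y + ereal (\<Sum>i<n. \<theta> $ i * of_bool (z $ i = - (y $ i)))"
  have finite_value: "?g z = ereal (label_gain n \<Delta> y (($) \<theta>) z)" if "z \<in> Z" for z
    using that not_inf [of z] by (cases "\<Delta> z y") (auto simp: finite_labelings_of_def label_gain_def)
  have "Max (?g ` labelings n) = ereal (max_gain n \<Delta> y (($) \<theta>))"
  proof (rule Max_eqI)
    show "finite (?g ` labelings n)" using finite_labelings by blast
    show "v \<le> ereal (max_gain n \<Delta> y (($) \<theta>))" if v: "v \<in> ?g ` labelings n" for v
    proof -
      obtain z where z: "v = ?g z" "z \<in> labelings n" using v by (rule imageE)
      show ?thesis
      proof (cases "z \<in> Z")
        case True
        then show ?thesis using z finite_value label_gain_le_max by simp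
      next
        case False
        then show ?thesis using z by (simp add: finite_labelings_of_def)
      qed
    qed
    obtain z where z: "z \<in> Z" "max_gain n \<Delta> y (($) \<theta>) = label_gain n \<Delta> y (($) \<theta>) z"
      using max_gain_attained by blast
    then show "ereal (max_gain n \<Delta> y (($) \<theta>)) \<in> ?g ` labelings n"
      using finite_value [of z]
      by (intro image_eqI [where x = z]) (auto simp: finite_labelings_of_def)
  qed
  moreover have "(SUP \<beta>\<in>{0..1::real}.
        (-\<mu> / 2) * \<beta>\<^sup>2 - ((2 / real n) * (y $ i) * (w \<bullet> x i) + \<theta> $ i) * \<beta>)
      = hub \<mu> (coeff_a n y w x i - \<theta> $ i)" for i
  proof -
    have "(2 / real n) * (y $ i) * (w \<bullet> x i) = - coeff_a n y w x i"
      by (simp add: coeff_a_def)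
    then show ?thesis
      using SUP_eq_hub [OF mu, of "coeff_a n y w x i - \<theta> $ i"] by (simp add: algebra_simps)
  qed
  ultimately show ?thesis
    by (simp add: objective_def real_objective_def)
qed

text \<open>Only the coordinates below \<open>n\<close> enter the objective, so a competing function
  may be truncated to the vector \<open>vec n f\<close>.\<close>

lemma optimal_iff:
  "optimal n \<mu> \<Delta> y w x \<theta> \<longleftrightarrow> \<theta> \<in> carrier_vec n \<and>
    (\<forall>f. real_objective n \<mu> \<Delta> y (coeff_a n y w x) (($) \<theta>)
       \<le> real_objective n \<mu> \<Delta> y (coeff_a n y w x) f)"
proof -
  have cong: "real_objective n \<mu> \<Delta> y a f = real_objective n \<mu> \<Delta> y a g"
    if "\<And>i. i < n \<Longrightarrow> f i = g i" for a f g
  proof -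
    have "label_gain n \<Delta> y f = label_gain n \<Delta> y g"
      using that by (auto simp: label_gain_def fun_eq_iff intro!: sum.cong)
    then show ?thesis
      using that by (auto simp: real_objective_def max_gain_def intro!: sum.cong)
  qed
  have "real_objective n \<mu> \<Delta> y a f = real_objective n \<mu> \<Delta> y a (($) (vec n f))" for a f
    by (rule cong) simp
  then show ?thesis
    unfolding optimal_def is_arg_min_def objective_eq
    by (simp add: not_less) (metis vec_carrier)
qed

section \<open>Clipping to the box does not increase the objective\<close>

lemma label_gain_diff:
  "label_gain n \<Delta> y f z - label_gain n \<Delta> y g z \<le> (\<Sum>i<n. max 0 (f i - g i))"
proof -
  have "label_gain n \<Delta> y f z - label_gain n \<Delta> y g z
      = (\<Sum>i<n. (f i - g i) * of_bool (z $ i = - (y $ i)))"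
    by (simp add: label_gain_def sum_subtractf left_diff_distrib)
  also have "\<dots> \<le> (\<Sum>i<n. max 0 (f i - g i))"
    by (intro sum_mono) auto
  finally show ?thesis .
qed

text \<open>A labeling that is best for \<open>f\<close> still competes for \<open>g\<close>, and
  each coordinate enters its gain with weight 0 or 1.\<close>

lemma max_gain_diff: "max_gain n \<Delta> y f \<le> max_gain n \<Delta> y g + (\<Sum>i<n. max 0 (f i - g i))"
proof -
  obtain z where "z \<in> Z" "max_gain n \<Delta> y f = label_gain n \<Delta> y f z"
    using max_gain_attained by blast
  then show ?thesis
    using label_gain_diff [of f z g] label_gain_le_max [of z g] by linarith
qed

lemma real_objective_clip:
  "real_objective n \<mu> \<Delta> y a (\<lambda>i. max (a i - \<mu>) (min (a i) (f i))) \<le> real_objective n \<mu> \<Delta> y a f"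
proof -
  let ?c = "\<lambda>i. max (a i - \<mu>) (min (a i) (f i))"
  have "(\<Sum>i<n. hub \<mu> (a i - ?c i) + max 0 (?c i - f i)) \<le> (\<Sum>i<n. hub \<mu> (a i - f i))"
    by (intro sum_mono hub_clip mu)
  then show ?thesis
    using max_gain_diff [of ?c f] by (simp add: real_objective_def sum.distrib)
qed

lemma optimal_clip:
  assumes "optimal n \<mu> \<Delta> y w x \<theta>"
  shows "optimal n \<mu> \<Delta> y w x (clip n (coeff_a n y w x) \<mu> \<theta>)"
proof -
  let ?a = "coeff_a n y w x"
  have "real_objective n \<mu> \<Delta> y ?a (($) (clip n ?a \<mu> \<theta>))
      = real_objective n \<mu> \<Delta> y ?a (\<lambda>i. max (?a i - \<mu>) (min (?a i) (\<theta> $ i)))"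
  proof -
    have "label_gain n \<Delta> y (($) (clip n ?a \<mu> \<theta>))
       = label_gain n \<Delta> y (\<lambda>i. max (?a i - \<mu>) (min (?a i) (\<theta> $ i)))"
      by (auto simp: label_gain_def fun_eq_iff clip_def intro!: sum.cong)
    then show ?thesis
      by (auto simp: real_objective_def max_gain_def clip_def intro!: sum.cong)
  qed
  moreover have "clip n ?a \<mu> \<theta> \<in> carrier_vec n" by (simp add: clip_def)
  ultimately show ?thesis
    using assms real_objective_clip [of ?a "($) \<theta>"] unfolding optimal_iff
    by (metis order_trans)
qed

section \<open>Existence and uniqueness of the minimizer in the box\<close>

lemma continuous_label_gain: "continuous_on S (\<lambda>f. label_gain n \<Delta> y f z)"
  unfolding label_gain_def
  by (intro continuous_on_add continuous_on_sum continuous_on_mult continuous_on_const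
      continuous_on_subset [OF continuous_on_product_coordinates]) auto

lemma continuous_max_gain: "continuous_on S (max_gain n \<Delta> y)"
proof -
  have "continuous_on S (\<lambda>f. Max ((\<lambda>z. label_gain n \<Delta> y f z) ` A))" if "finite A" "A \<noteq> {}" for A
    using that
  proof (induction A rule: finite_ne_induct)
    case (singleton z)
    then show ?case by (simp add: continuous_label_gain)
  next
    case (insert z A)
    then have "(\<lambda>f. Max ((\<lambda>z. label_gain n \<Delta> y f z) ` insert z A))
        = (\<lambda>f. max (label_gain n \<Delta> y f z) (Max ((\<lambda>z. label_gain n \<Delta> y f z) ` A)))"
      by simp
    then show ?case
      by (simp only:) (intro continuous_on_max continuous_label_gain insert.IH)
  qed
  from this [OF finite_Z Z_nonempty] show ?thesis
    by (simp add: max_gain_def [abs_def])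
qed

lemma ex_minimizer_in_box:
  "\<exists>f. (\<forall>i<n. f i \<in> {a i - \<mu>..a i}) \<and>
     (\<forall>g. real_objective n \<mu> \<Delta> y a f \<le> real_objective n \<mu> \<Delta> y a g)"
proof -
  \<comment> \<open>The coordinates from \<open>n\<close> on are confined as well, which makes the
    set a product of compact intervals.\<close>
  let ?B = "PiE UNIV (\<lambda>i. {a i - \<mu>..a i}) :: (nat \<Rightarrow> real) set"
  have "compactin (product_topology (\<lambda>_. euclidean) UNIV) ?B"
    by (simp add: compactin_PiE)
  then have "compact ?B" by (simp add: euclidean_product_topology)
  moreover have "?B \<noteq> {}" using mu by (auto simp: PiE_eq_empty_iff)
  moreover have "continuous_on ?B (real_objective n \<mu> \<Delta> y a)"
    unfolding real_objective_def [abs_def]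
  proof (rule continuous_on_add [OF continuous_max_gain], rule continuous_on_sum)
    fix i
    have "continuous_on ?B (\<lambda>f. a i - f i)"
      by (rule continuous_on_diff [OF continuous_on_const])
        (rule continuous_on_subset [OF continuous_on_product_coordinates], simp)
    then show "continuous_on ?B (\<lambda>f. hub \<mu> (a i - f i))"
      by (rule continuous_on_compose2 [OF continuous_hub [OF mu]]) simp
  qed
  ultimately have "\<exists>f\<in>?B. \<forall>g\<in>?B. real_objective n \<mu> \<Delta> y a f \<le> real_objective n \<mu> \<Delta> y a g"
    by (rule continuous_attains_inf)
  then obtain f where f: "f \<in> ?B"
    "\<And>g. g \<in> ?B \<Longrightarrow> real_objective n \<mu> \<Delta> y a f \<le> real_objective n \<mu> \<Delta> y a g"
    by blast
  \<comment> \<open>Clipping an arbitrary competitor brings it into the box, so minimality in the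
    box is minimality everywhere.\<close>
  have "real_objective n \<mu> \<Delta> y a f \<le> real_objective n \<mu> \<Delta> y a g" for g
  proof -
    have "(\<lambda>i. max (a i - \<mu>) (min (a i) (g i))) \<in> ?B" using mu by auto
    from f(2) [OF this] show ?thesis using real_objective_clip [of a g] by linarith
  qed
  then show ?thesis using f(1) by (auto simp: PiE_iff)
qed

lemma max_gain_midpoint:
  "max_gain n \<Delta> y (\<lambda>i. (f i + g i) / 2) \<le> (max_gain n \<Delta> y f + max_gain n \<Delta> y g) / 2"
proof -
  let ?h = "\<lambda>i. (f i + g i) / 2"
  obtain z where z: "z \<in> Z" "max_gain n \<Delta> y ?h = label_gain n \<Delta> y ?h z"
    using max_gain_attained by blast
  have "label_gain n \<Delta> y ?h z = (label_gain n \<Delta> y f z + label_gain n \<Delta> y g z) / 2"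
  proof -
    have "(\<Sum>i<n. ?h i * b i) = ((\<Sum>i<n. f i * b i) + (\<Sum>i<n. g i * b i)) / 2" for b
      by (simp add: sum.distrib [symmetric] sum_divide_distrib distrib_right)
    then show ?thesis by (simp only: label_gain_def) simp
  qed
  then show ?thesis
    using z label_gain_le_max [of z f] label_gain_le_max [of z g] by simp
qed

text \<open>At the midpoint of two minimizers the maximum over labelings is at most the average of
  its two values, while the loss is below its average by the sum of the convexity defects.
  Minimality leaves no room for a positive defect.\<close>

lemma minimizer_in_box_unique:
  assumes f: "\<And>i. i < n \<Longrightarrow> f i \<in> {a i - \<mu>..a i}"
      "\<And>h. real_objective n \<mu> \<Delta> y a f \<le> real_objective n \<mu> \<Delta> y a h"
    and g: "\<And>i. i < n \<Longrightarrow> g i \<in> {a i - \<mu>..a i}"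
      "\<And>h. real_objective n \<mu> \<Delta> y a g \<le> real_objective n \<mu> \<Delta> y a h"
    and "i < n"
  shows "f i = g i"
proof -
  let ?h = "\<lambda>i. (f i + g i) / 2"
  have "hub \<mu> (a i - ?h i) = (hub \<mu> (a i - f i) + hub \<mu> (a i - g i)) / 2 - (f i - g i)\<^sup>2 / (8 * \<mu>)"
    if "i < n" for i
  proof -
    have "a i - ?h i = ((a i - f i) + (a i - g i)) / 2" by (simp add: field_simps)
    then show ?thesis
      using hub_midpoint [OF mu, of "a i - f i" "a i - g i"] f(1) [OF that] g(1) [OF that]
      by (simp only:) (simp add: power2_commute)
  qed
  then have "(\<Sum>i<n. hub \<mu> (a i - ?h i))
      = ((\<Sum>i<n. hub \<mu> (a i - f i)) + (\<Sum>i<n. hub \<mu> (a i - g i))) / 2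
        - (\<Sum>i<n. (f i - g i)\<^sup>2 / (8 * \<mu>))"
    by (simp add: sum.distrib sum_subtractf sum_divide_distrib add_divide_distrib)
  \<comment> \<open>\<open>G\<close> and \<open>H\<close> stand for the maximum and the loss at the
    midpoint, \<open>S\<close> for the total defect; the two middle premises are the minimality of
    \<open>f\<close> and \<open>g\<close>, added up by the arithmetic.\<close>
  moreover have "S \<le> 0"
    if "H = (Hf + Hg) / 2 - S" "Gf + Hf \<le> G + H" "Gg + Hg \<le> G + H" "G \<le> (Gf + Gg) / 2"
    for S H Hf Hg G Gf Gg :: real
    using that by (simp add: field_simps)
  ultimately have "(\<Sum>i<n. (f i - g i)\<^sup>2 / (8 * \<mu>)) \<le> 0"
    using f(2) [of ?h] g(2) [of ?h] max_gain_midpoint [of f g]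
    unfolding real_objective_def by blast
  moreover have "(f i - g i)\<^sup>2 / (8 * \<mu>) \<le> (\<Sum>i<n. (f i - g i)\<^sup>2 / (8 * \<mu>))"
    using \<open>i < n\<close> mu by (intro member_le_sum) auto
  ultimately have "(f i - g i)\<^sup>2 / (8 * \<mu>) \<le> 0" by linarith
  then show ?thesis using mu by (simp add: divide_le_0_iff)
qed

lemma ex1_optimal_in_box:
  "\<exists>!\<theta>. optimal n \<mu> \<Delta> y w x \<theta> \<and> in_box n (coeff_a n y w x) \<mu> \<theta>"
proof -
  let ?a = "coeff_a n y w x"
  obtain f where f: "\<forall>i<n. f i \<in> {?a i - \<mu>..?a i}"
    "\<And>g. real_objective n \<mu> \<Delta> y ?a f \<le> real_objective n \<mu> \<Delta> y ?a g"
    using ex_minimizer_in_box by metis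
  have "label_gain n \<Delta> y (($) (vec n f)) = label_gain n \<Delta> y f"
    by (auto simp: label_gain_def fun_eq_iff intro!: sum.cong)
  then have "real_objective n \<mu> \<Delta> y ?a (($) (vec n f)) = real_objective n \<mu> \<Delta> y ?a f"
    by (auto simp: real_objective_def max_gain_def intro!: sum.cong)
  then have "optimal n \<mu> \<Delta> y w x (vec n f)" "in_box n ?a \<mu> (vec n f)"
    using f by (auto simp: optimal_iff in_box_def)
  moreover have "\<theta> = \<theta>'"
    if "optimal n \<mu> \<Delta> y w x \<theta> \<and> in_box n ?a \<mu> \<theta>" "optimal n \<mu> \<Delta> y w x \<theta>' \<and> in_box n ?a \<mu> \<theta>'"
    for \<theta> \<theta>'
  proof (rule eq_vecI)
    show "\<theta> $ i = \<theta>' $ i" if "i < dim_vec \<theta>'" for i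
      using that \<open>optimal n \<mu> \<Delta> y w x \<theta> \<and> _\<close> \<open>optimal n \<mu> \<Delta> y w x \<theta>' \<and> _\<close>
      by (intro minimizer_in_box_unique [of "($) \<theta>" ?a "($) \<theta>'"])
        (auto simp: optimal_iff in_box_def)
    show "dim_vec \<theta> = dim_vec \<theta>'"
      using that by (auto simp: optimal_iff)
  qed
  ultimately show ?thesis by blast
qed

end


section \<open>Balanced rounding\<close>

definition toggle :: "'a \<Rightarrow> 'a set \<Rightarrow> 'a set" where
  "toggle i S = (if i \<in> S then S - {i} else insert i S)"

lemma sum_toggle:
  fixes g :: "'a \<Rightarrow> real"
  assumes "finite S"
  shows "sum g (toggle i S) = sum g S + (if i \<in> S then - g i else g i)"
  using assms by (simp add: toggle_def sum_diff1)

lemma ex_between: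
  fixes L U :: "real set"
  assumes "finite L" "finite U" "\<And>l u. l \<in> L \<Longrightarrow> u \<in> U \<Longrightarrow> l \<le> u"
  shows "\<exists>m. (\<forall>l\<in>L. l \<le> m) \<and> (\<forall>u\<in>U. m \<le> u)"
proof (cases "L = {}")
  case True
  show ?thesis
  proof (cases "U = {}")
    case False
    then show ?thesis using True assms by (intro exI [of _ "Min U"]) auto
  qed (use True in auto)
next
  case False
  then show ?thesis using assms by (intro exI [of _ "Max L"]) auto
qed

text \<open>For a heaviest balanced set, exchanging two elements yields a Lagrange multiplier for the
  balance constraint, which makes the set optimal among the fractional selections as well.\<close>

lemma balanced_rounding:
  fixes \<sigma> w \<beta> :: "'a \<Rightarrow> real"
  assumes "finite I" and \<sigma>: "\<And>i. i \<in> I \<Longrightarrow> \<sigma> i \<in> {-1, 1}"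
    and \<beta>: "\<And>i. i \<in> I \<Longrightarrow> 0 \<le> \<beta> i \<and> \<beta> i \<le> 1"
    and balanced: "(\<Sum>i\<in>I. \<sigma> i * \<beta> i) = 0"
  shows "\<exists>S\<subseteq>I. sum \<sigma> S = 0 \<and> (\<Sum>i\<in>I. w i * \<beta> i) \<le> sum w S"
proof -
  let ?B = "{S. S \<subseteq> I \<and> sum \<sigma> S = 0}"
  have "finite ?B" using \<open>finite I\<close> by simp
  moreover have "{} \<in> ?B" by simp
  ultimately obtain S where S: "S \<in> ?B" and S_max: "\<And>S'. S' \<in> ?B \<Longrightarrow> sum w S' \<le> sum w S"
    using Max_ge [of "sum w ` ?B"] Max_in [of "sum w ` ?B"] by fastforce
  then have "finite S" using \<open>finite I\<close> by (auto intro: finite_subset)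
  \<comment> \<open>Toggling an element of \<open>?U\<close> lowers the signed sum by 1 and changes
    the weight by \<open>- \<sigma> i * w i\<close>; toggling an element of \<open>?L\<close> does
    the opposite. One toggle of each kind preserves balance.\<close>
  let ?U = "{i \<in> I. i \<in> S \<longleftrightarrow> \<sigma> i = 1}" and ?L = "{i \<in> I. i \<in> S \<longleftrightarrow> \<sigma> i \<noteq> 1}"
  have "\<sigma> j * w j \<le> \<sigma> i * w i" if i: "i \<in> ?U" and j: "j \<in> ?L" for i j
  proof -
    let ?S' = "toggle j (toggle i S)"
    have "i \<noteq> j" using i j by auto
    then have j_in: "j \<in> toggle i S \<longleftrightarrow> j \<in> S" by (auto simp: toggle_def)
    have "finite (toggle i S)" using \<open>finite S\<close> by (simp add: toggle_def)
    then have sum': "sum g ?S' = sum g S + (if i \<in> S then - g i else g i) + (if j \<in> S then - g j else g j)"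
      for g :: "'a \<Rightarrow> real"
      using \<open>finite S\<close> by (simp add: sum_toggle j_in)
    have "?S' \<subseteq> I" using S i j by (auto simp: toggle_def split: if_splits)
    moreover have "sum \<sigma> ?S' = 0" using sum' [of \<sigma>] S i j \<sigma> [of i] \<sigma> [of j] by auto
    ultimately have "sum w ?S' \<le> sum w S" using S_max by blast
    then show ?thesis using sum' [of w] i j \<sigma> [of i] \<sigma> [of j] by (auto split: if_splits)
  qed
  then obtain m where m: "\<And>i. i \<in> ?L \<Longrightarrow> \<sigma> i * w i \<le> m" "\<And>i. i \<in> ?U \<Longrightarrow> m \<le> \<sigma> i * w i"
    using ex_between [of "(\<lambda>i. \<sigma> i * w i) ` ?L" "(\<lambda>i. \<sigma> i * w i) ` ?U"] \<open>finite I\<close> by auto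
  let ?d = "\<lambda>i. of_bool (i \<in> S) :: real"
  have sum_S: "sum g S = (\<Sum>i\<in>I. g i * ?d i)" for g :: "'a \<Rightarrow> real"
    using S \<open>finite I\<close> by (auto intro!: sum.mono_neutral_cong_left)
  \<comment> \<open>The reduced weight \<open>w i - m * \<sigma> i\<close> is nonnegative on
    \<open>S\<close> and nonpositive off \<open>S\<close>, so the indicator of \<open>S\<close>
    maximizes every term separately.\<close>
  have "(w i - m * \<sigma> i) * \<beta> i \<le> (w i - m * \<sigma> i) * ?d i" if "i \<in> I" for i
    using m [of i] \<beta> [OF that] \<sigma> [OF that] that
    by (cases "i \<in> S") (auto intro: mult_left_le mult_nonpos_nonneg)
  then have "(\<Sum>i\<in>I. (w i - m * \<sigma> i) * \<beta> i) \<le> (\<Sum>i\<in>I. (w i - m * \<sigma> i) * ?d i)"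
    by (rule sum_mono)
  moreover have "(\<Sum>i\<in>I. (w i - m * \<sigma> i) * g i) = (\<Sum>i\<in>I. w i * g i) - m * (\<Sum>i\<in>I. \<sigma> i * g i)"
    for g
    by (simp add: left_diff_distrib sum_subtractf sum_distrib_left mult.assoc)
  ultimately have "(\<Sum>i\<in>I. w i * \<beta> i) \<le> sum w S"
    using balanced S sum_S [of \<sigma>] sum_S [of w] by simp
  then show ?thesis using S by blast
qed


section \<open>Optimality for the PRBEP discrepancy\<close>

text \<open>This is \<mu> times the slope of \<open>hub\<close>.\<close>

definition ramp :: "real \<Rightarrow> real \<Rightarrow> real" where
  "ramp \<mu> u = max 0 (min \<mu> u)"

text \<open>The bound is an argument of its own so that the loop invariant of the counting program
  can speak of a prefix of the labels.\<close>

definition pos_count :: "nat \<Rightarrow> real vec \<Rightarrow> nat" where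
  "pos_count n y = card {i. i < n \<and> y $ i = 1}"

locale prbep_problem =
  fixes n :: nat and \<mu> :: real and y :: "real vec"
  assumes mu: "\<mu> > 0" and y: "y \<in> labelings n"
begin

lemma dim_y: "dim_vec y = n" and y_cases: "i < n \<Longrightarrow> y $ i = 1 \<or> y $ i = -1"
  using y by (auto simp: labelings_def)

text \<open>The share of one flipped label in the discrepancy: on balanced labelings the discrepancy
  is the sum of these shares, hence linear in the flips.\<close>

definition bonus :: "nat \<Rightarrow> real" where
  "bonus i = of_bool (y $ i = 1) / real (pos_count n y)"

definition flip :: "nat set \<Rightarrow> real vec" where
  "flip S = vec n (\<lambda>i. if i \<in> S then - (y $ i) else y $ i)"

lemma flip_labeling: "flip S \<in> labelings n"
  using y by (auto simp: flip_def labelings_def)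

lemma flip_iff: "i < n \<Longrightarrow> flip S $ i = - (y $ i) \<longleftrightarrow> i \<in> S"
  using y_cases [of i] by (auto simp: flip_def)

lemma false_neg_eq:
  assumes "z \<in> labelings n"
  shows "real (false_neg z y) = (\<Sum>i<n. of_bool (y $ i = 1) * of_bool (z $ i = - (y $ i)))"
proof -
  have "{i. i < dim_vec y \<and> y $ i = 1 \<and> z $ i = - 1} = {i \<in> {..<n}. y $ i = 1 \<and> z $ i = - (y $ i)}"
    by (auto simp: dim_y)
  then show ?thesis
    by (simp add: false_neg_def of_bool_conj [symmetric] sum_of_bool_eq Int_def)
qed

lemma false_pos_eq:
  assumes "z \<in> labelings n"
  shows "real (false_pos z y) = (\<Sum>i<n. of_bool (y $ i = -1) * of_bool (z $ i = - (y $ i)))"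
proof -
  have "{i. i < dim_vec y \<and> y $ i = -1 \<and> z $ i = 1} = {i \<in> {..<n}. y $ i = -1 \<and> z $ i = - (y $ i)}"
    by (auto simp: dim_y)
  then show ?thesis
    by (simp add: false_pos_def of_bool_conj [symmetric] sum_of_bool_eq Int_def)
qed

lemma false_neg_minus_false_pos:
  assumes "z \<in> labelings n"
  shows "real (false_neg z y) - real (false_pos z y) = (\<Sum>i<n. y $ i * of_bool (z $ i = - (y $ i)))"
  unfolding false_neg_eq [OF assms] false_pos_eq [OF assms] sum_subtractf [symmetric]
  using y_cases by (intro sum.cong) auto

lemma prbep_balanced:
  assumes "z \<in> labelings n" "(\<Sum>i<n. y $ i * of_bool (z $ i = - (y $ i))) = 0"
  shows "prbep z y = ereal (\<Sum>i<n. bonus i * of_bool (z $ i = - (y $ i)))"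
proof -
  have "false_neg z y = false_pos z y"
    using false_neg_minus_false_pos [OF assms(1)] assms(2) by simp
  then have "prbep z y = ereal (real (false_neg z y) / real (pos_count n y))"
    by (simp add: prbep_def pos_count_def dim_y)
  also have "real (false_neg z y) / real (pos_count n y)
      = (\<Sum>i<n. bonus i * of_bool (z $ i = - (y $ i)))"
    unfolding false_neg_eq [OF assms(1)] sum_divide_distrib
    by (intro sum.cong) (auto simp: bonus_def)
  finally show ?thesis .
qed

lemma prbep_unbalanced:
  assumes "z \<in> labelings n" "(\<Sum>i<n. y $ i * of_bool (z $ i = - (y $ i))) \<noteq> 0"
  shows "prbep z y = -\<infinity>"
  using false_neg_minus_false_pos [OF assms(1)] assms(2) by (auto simp: prbep_def)

sublocale finite_discrepancy n \<mu> prbep y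
proof
  show "prbep z y \<noteq> \<infinity>" for z by (simp add: prbep_def Let_def)
  \<comment> \<open>The correct labeling itself flips nothing, hence is balanced and has a finite
    value.\<close>
  have "(\<Sum>i<n. y $ i * of_bool (flip {} $ i = - (y $ i))) = 0"
    by (simp add: flip_iff)
  from prbep_balanced [OF flip_labeling this] show "\<exists>z\<in>labelings n. prbep z y \<noteq> -\<infinity>"
    by (intro bexI [OF _ flip_labeling [of "{}"]]) simp
qed (rule mu)

lemma label_gain_balanced:
  assumes "z \<in> labelings n" "(\<Sum>i<n. y $ i * of_bool (z $ i = - (y $ i))) = 0"
  shows "label_gain n prbep y f z = (\<Sum>i<n. (bonus i + f i) * of_bool (z $ i = - (y $ i)))"
  unfolding label_gain_def prbep_balanced [OF assms] by (simp add: distrib_right sum.distrib)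

text \<open>The linear gain of a fractional balanced selection is reached by some balanced set of
  flips, and flipping such a set is a labeling of finite discrepancy.\<close>

lemma max_gain_lower:
  assumes \<beta>: "\<And>i. i < n \<Longrightarrow> 0 \<le> \<beta> i \<and> \<beta> i \<le> 1" and balanced: "(\<Sum>i<n. y $ i * \<beta> i) = 0"
  shows "(\<Sum>i<n. (bonus i + f i) * \<beta> i) \<le> max_gain n prbep y f"
proof -
  obtain S where S: "S \<subseteq> {..<n}" "(\<Sum>i\<in>S. y $ i) = 0"
      "(\<Sum>i<n. (bonus i + f i) * \<beta> i) \<le> (\<Sum>i\<in>S. bonus i + f i)"
    using balanced_rounding [of "{..<n}" "($) y" \<beta> "\<lambda>i. bonus i + f i"] assms y_cases by auto
  have sum_flip: "(\<Sum>i<n. g i * of_bool (flip S $ i = - (y $ i))) = sum g S" for g :: "nat \<Rightarrow> real"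
  proof -
    have "(\<Sum>i<n. g i * of_bool (flip S $ i = - (y $ i))) = (\<Sum>i<n. g i * of_bool (i \<in> S))"
      by (intro sum.cong) (simp_all only: flip_iff lessThan_iff)
    also have "\<dots> = sum g S"
      using S(1) by (auto simp: Int_absorb1 intro: arg_cong [where f = "sum g"])
    finally show ?thesis .
  qed
  have "label_gain n prbep y f (flip S) = (\<Sum>i\<in>S. bonus i + f i)"
    using label_gain_balanced [OF flip_labeling, of S f] S(2) unfolding sum_flip by blast
  moreover have "flip S \<in> finite_labelings_of n prbep y"
    using prbep_balanced [OF flip_labeling, of S] S(2) flip_labeling [of S]
    unfolding sum_flip finite_labelings_of_def by simp
  ultimately show ?thesis using S(3) label_gain_le_max [of "flip S" f] by simp
qed

text \<open>Before clipping, \<open>bonus i + \<theta> i\<close> would be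
  \<open>\<nu> * y $ i\<close>, which makes all balanced labelings equally good.\<close>

definition clipped_target :: "(nat \<Rightarrow> real) \<Rightarrow> real \<Rightarrow> nat \<Rightarrow> real" where
  "clipped_target a \<nu> i = max (a i - \<mu>) (min (a i) (\<nu> * y $ i - bonus i))"

text \<open>Complementary slackness: \<open>\<nu>\<close> is the multiplier of the balance constraint in the dual
  problem over \<open>\<beta>\<close>, and \<open>\<beta> i = (a i - \<theta> i) / \<mu>\<close> links both problems.\<close>

lemma clipped_target_minimizes:
  assumes balanced: "(\<Sum>i<n. y $ i * (a i - clipped_target a \<nu> i)) = 0"
  shows "real_objective n \<mu> prbep y a (clipped_target a \<nu>) \<le> real_objective n \<mu> prbep y a f"
proof -
  let ?\<theta> = "clipped_target a \<nu>"
  define \<beta> where "\<beta> i = (a i - ?\<theta> i) / \<mu>" for i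
  define D where "D = (\<Sum>i<n. (bonus i + a i) * \<beta> i - \<mu> / 2 * (\<beta> i)\<^sup>2)"
  have \<beta>: "0 \<le> \<beta> i \<and> \<beta> i \<le> 1" for i
    using mu by (auto simp: \<beta>_def clipped_target_def)
  have sum_\<beta>: "(\<Sum>i<n. y $ i * \<beta> i) = 0"
    using balanced by (simp add: \<beta>_def sum_divide_distrib [symmetric])
  \<comment> \<open>The terms with \<open>f\<close> cancel, so \<open>D\<close> is the same number
    for every \<open>f\<close>. Bounding both sums separately gives weak duality.\<close>
  have split: "D = (\<Sum>i<n. (bonus i + f i) * \<beta> i) + (\<Sum>i<n. (- \<mu> / 2) * (\<beta> i)\<^sup>2 + (a i - f i) * \<beta> i)" for f
    unfolding D_def sum.distrib [symmetric] by (intro sum.cong) (simp_all add: algebra_simps)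
  have "D \<le> real_objective n \<mu> prbep y a f"
    unfolding split [of f] real_objective_def
    using \<beta> by (intro add_mono max_gain_lower sum_mono hub_upper sum_\<beta> mu) auto
  \<comment> \<open>The duality gap closes: \<beta> is the maximizer in each loss, and it remains to
    see that no labeling gains more than \<beta>.\<close>
  moreover have "real_objective n \<mu> prbep y a ?\<theta> \<le> D"
  proof -
    have hub_eq: "hub \<mu> (a i - ?\<theta> i) = (- \<mu> / 2) * (\<beta> i)\<^sup>2 + (a i - ?\<theta> i) * \<beta> i" for i
    proof -
      have u: "a i - ?\<theta> i = \<mu> * \<beta> i" using mu by (simp add: \<beta>_def)
      have "hub \<mu> (\<mu> * \<beta> i) = (\<mu> * \<beta> i)\<^sup>2 / (2 * \<mu>)"
        using \<beta> [of i] mu by (intro hub_mid) auto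
      then show ?thesis
        unfolding u using mu by (simp add: power2_eq_square field_simps)
    qed
    obtain z where z: "z \<in> finite_labelings_of n prbep y"
        "max_gain n prbep y ?\<theta> = label_gain n prbep y ?\<theta> z"
      using max_gain_attained by blast
    define d where "d i = (of_bool (z $ i = - (y $ i)) :: real)" for i
    have z_lab: "z \<in> labelings n" and sum_d: "(\<Sum>i<n. y $ i * d i) = 0"
      using z(1) prbep_unbalanced [of z] by (auto simp: finite_labelings_of_def d_def)
    have "label_gain n prbep y ?\<theta> z = (\<Sum>i<n. (bonus i + ?\<theta> i) * d i)"
      using label_gain_balanced [OF z_lab] sum_d unfolding d_def by blast
    \<comment> \<open>A multiple of the balance is subtracted, which is zero for \<open>d\<close>
      and later, in the reverse direction, for \<beta>.\<close>
    also have "\<dots> = (\<Sum>i<n. (?\<theta> i - (\<nu> * y $ i - bonus i)) * d i)"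
    proof -
      have "(\<Sum>i<n. (?\<theta> i - (\<nu> * y $ i - bonus i)) * d i)
          = (\<Sum>i<n. (bonus i + ?\<theta> i) * d i) - \<nu> * (\<Sum>i<n. y $ i * d i)"
        unfolding sum_distrib_left sum_subtractf [symmetric]
        by (intro sum.cong) (simp_all add: algebra_simps)
      then show ?thesis using sum_d by simp
    qed
    \<comment> \<open>Where clipping lowers the target, \<open>?\<theta> i = a i\<close> and \<beta>
      is 0; where it raises the target, \<open>?\<theta> i = a i - \<mu>\<close> and \<beta> is 1.
      Either way \<beta> is the best choice in the unit interval for this term.\<close>
    also have "\<dots> \<le> (\<Sum>i<n. (?\<theta> i - (\<nu> * y $ i - bonus i)) * \<beta> i)"
    proof (rule sum_mono)
      fix i
      let ?t = "\<nu> * y $ i - bonus i"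
      have "?\<theta> i < ?t \<Longrightarrow> \<beta> i = 0" "?t < ?\<theta> i \<Longrightarrow> \<beta> i = 1"
        using mu by (auto simp: clipped_target_def \<beta>_def max_def min_def split: if_splits)
      then show "(?\<theta> i - ?t) * d i \<le> (?\<theta> i - ?t) * \<beta> i"
        by (cases "?\<theta> i" ?t rule: linorder_cases) (auto simp: d_def)
    qed
    also have "\<dots> = (\<Sum>i<n. (bonus i + ?\<theta> i) * \<beta> i)"
    proof -
      have "(\<Sum>i<n. (?\<theta> i - (\<nu> * y $ i - bonus i)) * \<beta> i)
          = (\<Sum>i<n. (bonus i + ?\<theta> i) * \<beta> i) - \<nu> * (\<Sum>i<n. y $ i * \<beta> i)"
        unfolding sum_distrib_left sum_subtractf [symmetric]
        by (intro sum.cong) (simp_all add: algebra_simps)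
      then show ?thesis using sum_\<beta> by simp
    qed
    finally have "max_gain n prbep y ?\<theta> \<le> (\<Sum>i<n. (bonus i + ?\<theta> i) * \<beta> i)"
      using z(2) by simp
    then show ?thesis
      unfolding split [of ?\<theta>] real_objective_def hub_eq by simp
  qed
  ultimately show ?thesis by linarith
qed

text \<open>For a positive label \<open>a i - clipped_target a \<nu> i\<close> falls from \<mu> to 0
  as \<nu> grows; written as \<mu> minus a rising ramp, it starts at this shift. For a negative
  label the difference is itself the rising ramp. Thus balance becomes one monotone equation in
  \<nu>.\<close>

definition shift :: "(nat \<Rightarrow> real) \<Rightarrow> nat \<Rightarrow> real" where
  "shift a i = (if y $ i = 1 then a i + 1 / real (pos_count n y) - \<mu> else - a i)"

lemma clipped_target_balanced:
  assumes "(\<Sum>i<n. ramp \<mu> (\<nu> - shift a i)) = \<mu> * real (pos_count n y)"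
  shows "(\<Sum>i<n. y $ i * (a i - clipped_target a \<nu> i)) = 0"
proof -
  have "y $ i * (a i - clipped_target a \<nu> i) = \<mu> * of_bool (y $ i = 1) - ramp \<mu> (\<nu> - shift a i)"
    if "i < n" for i
    using y_cases [OF that] mu
    by (auto simp: clipped_target_def ramp_def shift_def bonus_def max_def min_def)
  then have "(\<Sum>i<n. y $ i * (a i - clipped_target a \<nu> i))
      = \<mu> * (\<Sum>i<n. of_bool (y $ i = 1)) - (\<Sum>i<n. ramp \<mu> (\<nu> - shift a i))"
    by (simp add: sum_subtractf sum_distrib_left del: sum_of_bool_eq sum_mult_of_bool_eq)
  moreover have "(\<Sum>i<n. of_bool (y $ i = 1)) = real (pos_count n y)"
    by (simp add: pos_count_def sum_of_bool_eq Int_def)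
  ultimately show ?thesis using assms by simp
qed

lemma optimal_of_multiplier:
  assumes "(\<Sum>i<n. ramp \<mu> (\<nu> - shift (coeff_a n y w x) i)) = \<mu> * real (pos_count n y)"
    and \<theta>: "\<And>i. i < n \<Longrightarrow> \<theta> i = clipped_target (coeff_a n y w x) \<nu> i"
  shows "optimal n \<mu> prbep y w x (vec n \<theta>) \<and> in_box n (coeff_a n y w x) \<mu> (vec n \<theta>)"
proof
  let ?a = "coeff_a n y w x"
  have eq: "i < n \<Longrightarrow> vec n \<theta> $ i = clipped_target ?a \<nu> i" for i
    using \<theta> by simp
  then have "label_gain n prbep y (($) (vec n \<theta>)) = label_gain n prbep y (clipped_target ?a \<nu>)"
    by (auto simp: label_gain_def fun_eq_iff intro!: sum.cong)
  then have "real_objective n \<mu> prbep y ?a (($) (vec n \<theta>))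
      = real_objective n \<mu> prbep y ?a (clipped_target ?a \<nu>)"
    using eq by (auto simp: real_objective_def max_gain_def intro!: sum.cong)
  then show "optimal n \<mu> prbep y w x (vec n \<theta>)"
    using clipped_target_minimizes [OF clipped_target_balanced [OF assms(1)]]
    by (simp add: optimal_iff)
  show "in_box n ?a \<mu> (vec n \<theta>)"
    using eq mu by (auto simp: in_box_def clipped_target_def)
qed

end


section \<open>Reasoning about programs\<close>

text \<open>Big-step executions exist only for runs that terminate without getting stuck, so this
  expresses total correctness, with the running time handed to the postcondition.\<close>

definition wp :: "prog \<Rightarrow> ram \<Rightarrow> (nat \<Rightarrow> ram \<Rightarrow> bool) \<Rightarrow> bool" where
  "wp c s Q \<longleftrightarrow> (\<exists>t s'. exec c s t s' \<and> Q t s')"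

inductive_simps exec_iffs:
  "exec (ISet d k) s t s'" "exec (IAdd d u v) s t s'" "exec (ISub d u v) s t s'"
  "exec (RSet d k) s t s'" "exec (RAdd d u v) s t s'" "exec (RSub d u v) s t s'"
  "exec (RMul d u v) s t s'" "exec (RDiv d u v) s t s'" "exec (Load d u) s t s'"
  "exec (Store u v) s t s'" "exec (Seq c c') s t s'" "exec (Cond b c c') s t s'"

lemma wp_simps [simp]:
  "wp (ISet d k) s Q = Q 1 (s\<lparr>ireg := (ireg s)(d := k)\<rparr>)"
  "wp (IAdd d u v) s Q = Q 1 (s\<lparr>ireg := (ireg s)(d := ireg s u + ireg s v)\<rparr>)"
  "wp (ISub d u v) s Q = Q 1 (s\<lparr>ireg := (ireg s)(d := ireg s u - ireg s v)\<rparr>)"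
  "wp (RSet d k) s Q = Q 1 (s\<lparr>rreg := (rreg s)(d := real k)\<rparr>)"
  "wp (RAdd d u v) s Q = Q 1 (s\<lparr>rreg := (rreg s)(d := rreg s u + rreg s v)\<rparr>)"
  "wp (RSub d u v) s Q = Q 1 (s\<lparr>rreg := (rreg s)(d := rreg s u - rreg s v)\<rparr>)"
  "wp (RMul d u v) s Q = Q 1 (s\<lparr>rreg := (rreg s)(d := rreg s u * rreg s v)\<rparr>)"
  "wp (RDiv d u v) s Q
    \<longleftrightarrow> rreg s v \<noteq> 0 \<and> Q 1 (s\<lparr>rreg := (rreg s)(d := rreg s u / rreg s v)\<rparr>)"
  "wp (Load d u) s Q = Q 1 (s\<lparr>rreg := (rreg s)(d := mem s (ireg s u))\<rparr>)"
  "wp (Store u v) s Q = Q 1 (s\<lparr>mem := (mem s)(ireg s u := rreg s v)\<rparr>)"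
  by (auto simp: wp_def exec_iffs)

lemma wp_Seq [simp]: "wp (Seq c c') s Q = wp c s (\<lambda>t s'. wp c' s' (\<lambda>t'. Q (t + t')))"
  by (simp add: wp_def exec_iffs) blast

lemma wp_Cond [simp]:
  "wp (Cond b c c') s Q
    \<longleftrightarrow> (if holds b s then wp c s (\<lambda>t. Q (1 + t)) else wp c' s (\<lambda>t. Q (1 + t)))"
  by (auto simp: wp_def exec_iffs)

lemma wp_mono: "wp c s Q \<Longrightarrow> (\<And>t s'. Q t s' \<Longrightarrow> R t s') \<Longrightarrow> wp c s R"
  by (auto simp: wp_def)

text \<open>The index \<open>k\<close> of the invariant is a potential that pays for the remaining running time.\<close>

lemma wp_While:
  assumes "I k s"
    and "\<And>k s. I k s \<Longrightarrow> holds b s \<Longrightarrow> wp c s (\<lambda>t s'. \<exists>k'. I k' s' \<and> 1 + t + k' \<le> k)"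
    and "\<And>k' t s'. I k' s' \<Longrightarrow> \<not> holds b s' \<Longrightarrow> t + k' \<le> k + 1 \<Longrightarrow> Q t s'"
  shows "wp (While b c) s Q"
proof -
  \<comment> \<open>The extra 1 is the final test that fails.\<close>
  have "\<exists>t s' k'. exec (While b c) s t s' \<and> I k' s' \<and> \<not> holds b s' \<and> t + k' \<le> k + 1"
    using assms(1)
  proof (induction k arbitrary: s rule: less_induct)
    case (less k)
    show ?case
    proof (cases "holds b s")
      case True
      then obtain t s' k' where body: "exec c s t s'" "I k' s'" "1 + t + k' \<le> k"
        using assms(2) [OF less.prems] by (auto simp: wp_def)
      then obtain t' s'' k'' where "exec (While b c) s' t' s''" "I k'' s''" "\<not> holds b s''"
          "t' + k'' \<le> k' + 1"
        using less.IH [of k' s'] by auto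
      moreover from this have "exec (While b c) s (1 + t + t') s''"
        using exec.WhileTrue True body by blast
      ultimately show ?thesis using body by force
    next
      case False
      then show ?thesis using exec.WhileFalse less.prems by fastforce
    qed
  qed
  then show ?thesis using assms(3) unfolding wp_def by blast
qed

text \<open>The machine has no idle instruction; register 19 serves no other purpose in the programs
  below.\<close>

abbreviation skip :: prog where
  "skip \<equiv> ISet 19 0"

fun block :: "prog list \<Rightarrow> prog" where
  "block [] = skip"
| "block [c] = c"
| "block (c # d # cs) = Seq c (block (d # cs))"


section \<open>Heapsort\<close>

text \<open>The state of a max-heap during sifting down: only \<open>i\<close> may be smaller than
  its children. The second conjunct, comparing these children with the parent of \<open>i\<close>,
  is what restores order at \<open>i\<close> once a child has moved up.\<close>

definition heap_hole :: "(nat \<Rightarrow> real) \<Rightarrow> nat \<Rightarrow> nat \<Rightarrow> nat \<Rightarrow> bool" where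
  "heap_hole h m k i \<longleftrightarrow>
     (\<forall>c. 0 < c \<and> c < m \<and> k \<le> (c - 1) div 2 \<and> (c - 1) div 2 \<noteq> i \<longrightarrow> h c \<le> h ((c - 1) div 2)) \<and>
     (\<forall>c. 0 < i \<and> k \<le> (i - 1) div 2 \<and> 0 < c \<and> c < m \<and> (c - 1) div 2 = i \<longrightarrow> h c \<le> h ((i - 1) div 2))"

definition heap_from :: "(nat \<Rightarrow> real) \<Rightarrow> nat \<Rightarrow> nat \<Rightarrow> bool" where
  "heap_from h m k \<longleftrightarrow> (\<forall>c. 0 < c \<and> c < m \<and> k \<le> (c - 1) div 2 \<longrightarrow> h c \<le> h ((c - 1) div 2))"

text \<open>\<open>0 < c\<close> excludes the root, which truncated subtraction would make its own
  parent.\<close>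

lemma children: "0 < c \<Longrightarrow> (c - 1) div 2 = i \<longleftrightarrow> c = 2 * i + 1 \<or> c = 2 * i + (2::nat)"
  by auto

lemma heap_hole_stop:
  assumes "heap_hole h m k i" "2 * i + 1 < m \<Longrightarrow> h (2 * i + 1) \<le> h i" "2 * i + 2 < m \<Longrightarrow> h (2 * i + 2) \<le> h i"
  shows "heap_from h m k"
  unfolding heap_from_def
proof (intro allI impI)
  fix c assume c: "0 < c \<and> c < m \<and> k \<le> (c - 1) div 2"
  show "h c \<le> h ((c - 1) div 2)"
  proof (cases "(c - 1) div 2 = i")
    case True
    then have "c = 2 * i + 1 \<or> c = 2 * i + 2" using c children by blast
    then show ?thesis using assms(2,3) c True by auto
  next
    case False
    then show ?thesis using assms(1) c by (auto simp: heap_hole_def)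
  qed
qed

lemma heap_hole_swap:
  assumes hole: "heap_hole h m k i" and c: "c = 2 * i + 1 \<or> c = 2 * i + 2" "c < m" and "k \<le> i"
    and bigger: "h i < h c" "2 * i + 1 < m \<Longrightarrow> h (2 * i + 1) \<le> h c" "2 * i + 2 < m \<Longrightarrow> h (2 * i + 2) \<le> h c"
  shows "heap_hole (h(i := h c, c := h i)) m k c"
proof -
  let ?h = "h(i := h c, c := h i)"
  have "i \<noteq> c" using c by auto
  have parent_c: "(c - 1) div 2 = i" using c by auto
  have "?h d \<le> ?h ((d - 1) div 2)"
    if d: "0 < d" "d < m" "k \<le> (d - 1) div 2" "(d - 1) div 2 \<noteq> c" for d
  proof (cases "(d - 1) div 2 = i")
    case True
    then have "d = 2 * i + 1 \<or> d = 2 * i + 2" using d(1) children by blast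
    then show ?thesis using bigger d True \<open>i \<noteq> c\<close> by auto
  next
    case False
    then have "d \<noteq> c" using parent_c by auto
    have "h d \<le> h ((d - 1) div 2)" using hole d False unfolding heap_hole_def by blast
    \<comment> \<open>The promoted child now faces the old parent of \<open>i\<close>: the second
      conjunct of \<open>heap_hole\<close>.\<close>
    moreover have "h c \<le> h ((i - 1) div 2)" if "d = i"
      using hole d c that parent_c unfolding heap_hole_def by auto
    ultimately show ?thesis using d(4) False \<open>d \<noteq> c\<close> \<open>i \<noteq> c\<close> by auto
  qed
  moreover have "?h d \<le> ?h ((c - 1) div 2)" if d: "0 < d" "d < m" "(d - 1) div 2 = c" for d
  proof -
    have "d \<noteq> i" "d \<noteq> c" using d c by auto
    have "h d \<le> h c" using hole d \<open>i \<noteq> c\<close> \<open>k \<le> i\<close> c unfolding heap_hole_def by auto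
    then show ?thesis using \<open>d \<noteq> i\<close> \<open>d \<noteq> c\<close> \<open>i \<noteq> c\<close> parent_c by simp
  qed
  ultimately show ?thesis unfolding heap_hole_def by blast
qed

lemma heap_max:
  assumes "heap_from h m 0" "i < m"
  shows "h i \<le> h 0"
  using assms(2)
proof (induction i rule: less_induct)
  case (less i)
  show ?case
  proof (cases "i = 0")
    case False
    then have "h i \<le> h ((i - 1) div 2)" using assms(1) less.prems by (auto simp: heap_from_def)
    also have "\<dots> \<le> h 0" using less False by auto
    finally show ?thesis .
  qed simp
qed

section \<open>Sifting down on the machine\<close>

definition arr :: "ram \<Rightarrow> nat \<Rightarrow> nat \<Rightarrow> real" where
  "arr s B i = mem s (B + i)"

text \<open>Integer register 11 holds the hole, 5 its left child and then the larger child, 6 the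
  heap size. Copies are additions of a register that holds 0. If no exchange happens, register 5 is
  set to the heap size to end the loop.\<close>

definition sift_step :: prog where
  "sift_step = block [
     IAdd 4 1 11, IAdd 7 1 5, Load 5 4, Load 6 7, IAdd 12 5 2,
     Cond (ILess 12 6)
       (block [IAdd 13 7 2, Load 7 13,
         Cond (RLess 6 7) (block [IAdd 5 12 10, IAdd 7 13 10, RAdd 6 7 1]) skip])
       skip,
     Cond (RLess 5 6)
       (block [Store 4 6, Store 7 5, IAdd 11 5 10, IAdd 5 11 11, IAdd 5 5 2])
       (IAdd 5 6 10)]"

definition sift :: prog where
  "sift = block [IAdd 5 11 11, IAdd 5 5 2, While (ILess 5 6) sift_step]"

text \<open>Integer registers 0, 1, 2, 10 hold \<open>n\<close>, the base address \<open>2n\<close> of the array, 1 and 0; real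
  registers 0, 1, 2, 3, 4 hold \<open>\<mu>\<close>, 0, 1, the number of positive labels and its inverse.\<close>

definition fixed_regs :: "ram \<Rightarrow> nat \<Rightarrow> real \<Rightarrow> real \<Rightarrow> real \<Rightarrow> bool" where
  "fixed_regs s n \<mu> m c \<longleftrightarrow>
     ireg s 0 = n \<and> ireg s (Suc 0) = 2 * n \<and> ireg s 2 = 1 \<and> ireg s 10 = 0 \<and>
     rreg s 0 = \<mu> \<and> rreg s (Suc 0) = 0 \<and> rreg s 2 = 1 \<and> rreg s 3 = m \<and> rreg s 4 = c"

lemma swap_permutes:
  fixes h :: "nat \<Rightarrow> real"
  assumes "i < m" "j < m"
  shows "\<exists>\<pi>. \<pi> permutes {..<m} \<and> h(i := h j, j := h i) = h \<circ> \<pi>"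
  using assms
  by (intro exI [of _ "Transposition.transpose i j"])
    (auto simp: permutes_swap_id fun_eq_iff transpose_def)

lemma permuted_trans:
  assumes "\<exists>\<pi>. \<pi> permutes {..<m} \<and> h' = h \<circ> \<pi>" "\<exists>\<pi>. \<pi> permutes {..<m} \<and> h'' = h' \<circ> \<pi>"
  shows "\<exists>\<pi>. \<pi> permutes {..<m::nat} \<and> h'' = h \<circ> \<pi>"
  using assms by (metis comp_assoc permutes_compose)

lemma arr_upd [simp]:
  "arr (s\<lparr>ireg := f\<rparr>) B = arr s B" "arr (s\<lparr>rreg := g\<rparr>) B = arr s B"
  by (auto simp: arr_def fun_eq_iff)

lemma wp_sift_step:
  assumes fixed: "fixed_regs s n \<mu> m c" and child: "ireg s 5 = 2 * ireg s 11 + 1" "ireg s 5 < ireg s 6"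
    and hole: "heap_hole (arr s (2 * n)) (ireg s 6) k (ireg s 11)" and "k \<le> ireg s 11"
    and stop: "\<And>t s'. fixed_regs s' n \<mu> m c \<Longrightarrow> ireg s' 6 = ireg s 6 \<Longrightarrow> ireg s' 3 = ireg s 3 \<Longrightarrow>
      mem s' = mem s \<Longrightarrow> ireg s' 5 = ireg s 6 \<Longrightarrow> heap_from (arr s (2 * n)) (ireg s 6) k \<Longrightarrow>
      t \<le> 19 \<Longrightarrow> Q t s'"
    and step: "\<And>(t::nat) s' i. fixed_regs s' n \<mu> m c \<Longrightarrow> ireg s' 6 = ireg s 6 \<Longrightarrow> ireg s' 3 = ireg s 3 \<Longrightarrow>
      mem s' = (mem s)(2 * n + ireg s 11 := arr s (2 * n) i, 2 * n + i := arr s (2 * n) (ireg s 11)) \<Longrightarrow>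
      2 * ireg s 11 < i \<Longrightarrow> i < ireg s 6 \<Longrightarrow> ireg s' 11 = i \<Longrightarrow> ireg s' 5 = 2 * i + 1 \<Longrightarrow>
      heap_hole ((arr s (2 * n))(ireg s 11 := arr s (2 * n) i, i := arr s (2 * n) (ireg s 11)))
        (ireg s 6) k i \<Longrightarrow>
      t \<le> 19 \<Longrightarrow> Q t s'"
  shows "wp sift_step s Q"
proof -
  let ?i = "ireg s 11" and ?N = "ireg s 6" and ?h = "arr s (2 * n)"
  note regs = fixed [unfolded fixed_regs_def] child(1)
  have left: "2 * ?i + 1 < ?N" using child by simp
  have moved: "heap_hole (?h(?i := ?h i, i := ?h ?i)) ?N k i"
    if "i = 2 * ?i + 1 \<or> i = 2 * ?i + 2" "i < ?N" "?h ?i < ?h i" "?h (2 * ?i + 1) \<le> ?h i"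
      "2 * ?i + 2 < ?N \<Longrightarrow> ?h (2 * ?i + 2) \<le> ?h i" for i
    using heap_hole_swap [OF hole that(1,2) \<open>k \<le> ?i\<close> that(3)] that(4,5) by blast
  show ?thesis
  proof (cases "2 * ?i + 2 < ?N \<and> ?h (2 * ?i + 1) < ?h (2 * ?i + 2)")
    case right: True
    show ?thesis
    proof (cases "?h ?i < ?h (2 * ?i + 2)")
      case True
      with right have "heap_hole (?h(?i := ?h (2 * ?i + 2), 2 * ?i + 2 := ?h ?i)) ?N k (2 * ?i + 2)"
        by (intro moved) auto
      with True right show ?thesis
        by (simp add: sift_step_def regs arr_def; intro step [where i = "2 * ?i + 2"];
            use fixed in \<open>auto simp: fixed_regs_def arr_def\<close>)
    next
      case False
      with right have "heap_from ?h ?N k"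
        by (intro heap_hole_stop [OF hole]) auto
      with False right show ?thesis
        by (simp add: sift_step_def regs arr_def; intro stop;
            use fixed in \<open>auto simp: fixed_regs_def arr_def\<close>)
    qed
  next
    case not_right: False
    show ?thesis
    proof (cases "?h ?i < ?h (2 * ?i + 1)")
      case True
      with not_right left have "heap_hole (?h(?i := ?h (2 * ?i + 1), 2 * ?i + 1 := ?h ?i)) ?N k (2 * ?i + 1)"
        by (intro moved) auto
      with True not_right left show ?thesis
        by (cases "2 * ?i + 2 < ?N"; simp add: sift_step_def regs arr_def; intro step [where i = "2 * ?i + 1"];
            use fixed in \<open>auto simp: fixed_regs_def arr_def\<close>)
    next
      case False
      with not_right have "heap_from ?h ?N k"
        by (intro heap_hole_stop [OF hole]) auto
      with False not_right left show ?thesis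
        by (cases "2 * ?i + 2 < ?N"; simp add: sift_step_def regs arr_def; intro stop;
            use fixed in \<open>auto simp: fixed_regs_def arr_def\<close>)
    qed
  qed
qed

text \<open>The exponent \<open>e\<close> bounds the levels left below the hole. Moving from
  \<open>i\<close> to a child at least doubles \<open>i + 1\<close>, so \<open>e\<close> drops by
  one; at \<open>e = 0\<close> the hole has no child. Each level costs at most 19 instructions and
  one loop test.\<close>

lemma wp_sift:
  assumes fixed: "fixed_regs s n \<mu> m c"
    and hole: "heap_hole (arr s (2 * n)) (ireg s 6) k (ireg s 11)" and "k \<le> ireg s 11"
    and room: "ireg s 6 < (ireg s 11 + 1) * 2 ^ e"
    and Q: "\<And>t s'. fixed_regs s' n \<mu> m c \<Longrightarrow> ireg s' 6 = ireg s 6 \<Longrightarrow> ireg s' 3 = ireg s 3 \<Longrightarrow>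
      heap_from (arr s' (2 * n)) (ireg s 6) k \<Longrightarrow>
      \<exists>\<pi>. \<pi> permutes {..<ireg s 6} \<and> arr s' (2 * n) = arr s (2 * n) \<circ> \<pi> \<Longrightarrow>
      (\<forall>i<2 * n. mem s' i = mem s i) \<Longrightarrow>
      t \<le> 3 + 20 * e \<Longrightarrow> Q t s'"
  shows "wp sift s Q"
proof -
  let ?h = "\<lambda>s. arr s (2 * n)"
  define N where "N = ireg s 6"
  define frame where "frame s' \<longleftrightarrow> fixed_regs s' n \<mu> m c \<and> ireg s' 6 = N \<and> ireg s' 3 = ireg s 3 \<and>
      (\<forall>i<2 * n. mem s' i = mem s i) \<and> (\<exists>\<pi>. \<pi> permutes {..<N} \<and> ?h s' = ?h s \<circ> \<pi>)" for s'
  define sifting where "sifting e s' \<longleftrightarrow> N < (ireg s' 11 + 1) * 2 ^ e \<and> ireg s' 5 = 2 * ireg s' 11 + 1 \<and>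
       k \<le> ireg s' 11 \<and> heap_hole (?h s') N k (ireg s' 11)" for e s'
  \<comment> \<open>In the second alternative the potential is unconstrained, because the loop stops
    at the next test.\<close>
  define I where "I q s' \<longleftrightarrow> frame s' \<and>
     ((\<exists>e. q = 20 * e \<and> sifting e s') \<or> N \<le> ireg s' 5 \<and> heap_from (?h s') N k)" for q s'
  have exit: "heap_from (?h s') N k" if "I q s'" "N \<le> ireg s' 5" for q s'
    using that by (auto simp: I_def sifting_def intro: heap_hole_stop)
  let ?s = "s\<lparr>ireg := (ireg s)(5 := 2 * ireg s 11 + 1)\<rparr>"
  have "wp (While (ILess 5 6) sift_step) ?s (\<lambda>t. Q (2 + t))"
  proof (rule wp_While [where I = I and k = "20 * e"])
    have "\<exists>\<pi>. \<pi> permutes {..<N} \<and> ?h s = ?h s \<circ> \<pi>"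
      by (intro exI [of _ id]) (simp add: permutes_id)
    then have "frame ?s" "sifting e ?s"
      using assms by (auto simp: frame_def sifting_def fixed_regs_def N_def)
    then show "I (20 * e) ?s" unfolding I_def by blast
  next
    fix q s'
    assume I: "I q s'" and "holds (ILess 5 6) s'"
    then have less: "ireg s' 5 < N" by (auto simp: I_def frame_def)
    then obtain e where e: "q = 20 * e" "sifting e s'" and frame: "frame s'"
      using I by (auto simp: I_def)
    then obtain e' where e': "e = Suc e'"
      using less by (cases e) (auto simp: sifting_def)
    show "wp sift_step s' (\<lambda>t s''. \<exists>q'. I q' s'' \<and> 1 + t + q' \<le> q)"
    proof (rule wp_sift_step [of s' n \<mu> m c k])
      fix t :: nat and s'' i
      assume s'': "fixed_regs s'' n \<mu> m c" "ireg s'' 6 = ireg s' 6" "ireg s'' 3 = ireg s' 3"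
        and mem: "mem s'' = (mem s')(2 * n + ireg s' 11 := ?h s' i, 2 * n + i := ?h s' (ireg s' 11))"
        and i: "2 * ireg s' 11 < i" "i < ireg s' 6" "ireg s'' 11 = i" "ireg s'' 5 = 2 * i + 1"
        and hole: "heap_hole ((?h s')(ireg s' 11 := ?h s' i, i := ?h s' (ireg s' 11))) (ireg s' 6) k i"
        and "t \<le> 19"
      have h: "?h s'' = (?h s')(ireg s' 11 := ?h s' i, i := ?h s' (ireg s' 11))"
        by (auto simp: arr_def mem fun_eq_iff)
      have "\<exists>\<pi>. \<pi> permutes {..<N} \<and> ?h s'' = ?h s \<circ> \<pi>"
        using frame i unfolding h frame_def
        by (intro permuted_trans [OF _ swap_permutes]) auto
      then have "frame s''"
        using frame s'' mem unfolding frame_def by auto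
      moreover have "N < (i + 1) * 2 ^ e'"
      proof -
        have "N < (2 * ireg s' 11 + 2) * 2 ^ e'"
          using e e' by (auto simp: sifting_def algebra_simps)
        also have "\<dots> \<le> (i + 1) * 2 ^ e'" using i by (intro mult_right_mono) auto
        finally show ?thesis .
      qed
      then have "sifting e' s''"
        using e(2) s'' i hole frame unfolding sifting_def h frame_def by auto
      ultimately show "\<exists>q'. I q' s'' \<and> 1 + t + q' \<le> q"
        using \<open>t \<le> 19\<close> e(1) e' unfolding I_def by (intro exI [of _ "20 * e'"]) auto
    next
      fix t :: nat and s''
      assume "fixed_regs s'' n \<mu> m c" "ireg s'' 6 = ireg s' 6" "ireg s'' 3 = ireg s' 3"
        "mem s'' = mem s'" "ireg s'' 5 = ireg s' 6" "heap_from (?h s') (ireg s' 6) k" "t \<le> 19"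
      moreover from this have "?h s'' = ?h s'" by (simp add: arr_def fun_eq_iff)
      ultimately show "\<exists>q'. I q' s'' \<and> 1 + t + q' \<le> q"
        using frame e(1) e' unfolding I_def frame_def by (intro exI [of _ 0]) auto
    qed (use e frame less in \<open>auto simp: sifting_def frame_def\<close>)
  next
    fix q t :: nat and s'
    assume "I q s'" "\<not> holds (ILess 5 6) s'" "t + q \<le> 20 * e + 1"
    moreover from this have "heap_from (?h s') N k"
      by (intro exit) (auto simp: I_def frame_def)
    ultimately show "Q (2 + t) s'"
      by (intro Q) (auto simp: I_def frame_def N_def)
  qed
  then show ?thesis
    using fixed by (simp add: sift_def fixed_regs_def mult_2)
qed


section \<open>Building the heap and extracting maxima\<close>

definition permuted :: "nat \<Rightarrow> ram \<Rightarrow> ram \<Rightarrow> bool" where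
  "permuted n s s' \<longleftrightarrow> (\<forall>i<2 * n. mem s' i = mem s i) \<and>
     (\<exists>\<pi>. \<pi> permutes {..<n} \<and> arr s' (2 * n) = arr s (2 * n) \<circ> \<pi>)"

lemma permuted_refl: "mem s' = mem s \<Longrightarrow> permuted n s s'"
  unfolding permuted_def by (auto simp: arr_def fun_eq_iff intro: exI [of _ id] permutes_id)

lemma permuted_extend:
  assumes "permuted n s s'" "\<forall>i<2 * n. mem s'' i = mem s' i"
    and "\<exists>\<pi>. \<pi> permutes {..<m} \<and> arr s'' (2 * n) = arr s' (2 * n) \<circ> \<pi>" "m \<le> n"
  shows "permuted n s s''"
proof -
  have "\<exists>\<pi>. \<pi> permutes {..<n} \<and> arr s'' (2 * n) = arr s' (2 * n) \<circ> \<pi>"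
    using assms(3,4) permutes_subset by (metis lessThan_subset_iff)
  then show ?thesis
    using assms(1,2) unfolding permuted_def by (auto intro: permuted_trans)
qed

text \<open>The descent starts at \<open>n - 1\<close> instead of the last inner node, which would
  require halving \<open>n\<close>.\<close>

definition heapify :: prog where
  "heapify = block [IAdd 6 0 10, IAdd 3 0 10,
     While (ILess 10 3) (block [ISub 3 3 2, IAdd 11 3 10, sift])]"

lemma wp_heapify:
  assumes fixed: "fixed_regs s n \<mu> m c" and e: "n < 2 ^ e"
    and Q: "\<And>t s'. fixed_regs s' n \<mu> m c \<Longrightarrow> ireg s' 6 = n \<Longrightarrow> heap_from (arr s' (2 * n)) n 0 \<Longrightarrow>
      permuted n s s' \<Longrightarrow> t \<le> 3 + n * (6 + 20 * e) \<Longrightarrow> Q t s'"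
  shows "wp heapify s Q"
proof -
  let ?h = "\<lambda>s. arr s (2 * n)"
  define I where "I q s' \<longleftrightarrow> fixed_regs s' n \<mu> m c \<and> ireg s' 6 = n \<and> ireg s' 3 \<le> n \<and>
     q = ireg s' 3 * (6 + 20 * e) \<and> heap_from (?h s') n (ireg s' 3) \<and> permuted n s s'" for q s'
  let ?s = "s\<lparr>ireg := (ireg s)(6 := n, 3 := n)\<rparr>"
  have "wp (While (ILess 10 3) (block [ISub 3 3 2, IAdd 11 3 10, sift])) ?s (\<lambda>t. Q (2 + t))"
  proof (rule wp_While [where I = I and k = "n * (6 + 20 * e)"])
    show "I (n * (6 + 20 * e)) ?s"
      using fixed by (auto simp: I_def fixed_regs_def heap_from_def permuted_refl)
  next
    fix q s'
    assume I: "I q s'" and "holds (ILess 10 3) s'"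
    then obtain i where i: "ireg s' 3 = Suc i"
      by (cases "ireg s' 3") (auto simp: I_def fixed_regs_def)
    have fixed': "fixed_regs s' n \<mu> m c" and heap: "heap_from (?h s') n (Suc i)"
      and q: "q = Suc i * (6 + 20 * e)"
      using I i by (auto simp: I_def)
    \<comment> \<open>The parent of \<open>i\<close> lies outside the range from \<open>i\<close>
      on, so the second conjunct is vacuous.\<close>
    have hole: "heap_hole (?h s') n i i"
      using heap unfolding heap_hole_def heap_from_def by auto
    let ?s' = "s'\<lparr>ireg := (ireg s')(3 := i, 11 := i)\<rparr>"
    have sift: "wp sift ?s' (\<lambda>t s''. \<exists>q'. I q' s'' \<and> 3 + t + q' \<le> q)"
    proof (rule wp_sift [where n = n and \<mu> = \<mu> and m = m and c = c and k = i and e = e])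
      show "ireg ?s' 6 < (ireg ?s' 11 + 1) * 2 ^ e"
        using e I by (simp add: I_def)
    next
      fix t :: nat and s''
      assume s'': "fixed_regs s'' n \<mu> m c" "ireg s'' 6 = ireg ?s' 6" "ireg s'' 3 = ireg ?s' 3"
        "heap_from (?h s'') (ireg ?s' 6) i"
        "\<exists>\<pi>. \<pi> permutes {..<ireg ?s' 6} \<and> ?h s'' = ?h ?s' \<circ> \<pi>"
        "\<forall>i<2 * n. mem s'' i = mem ?s' i" "t \<le> 3 + 20 * e"
      then have "permuted n s s''"
        using I by (intro permuted_extend [of n s s' s'' n]) (auto simp: I_def)
      then have "I (i * (6 + 20 * e)) s''"
        using s'' I i by (auto simp: I_def)
      then show "\<exists>q'. I q' s'' \<and> 3 + t + q' \<le> q"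
        using q \<open>t \<le> 3 + 20 * e\<close> by (intro exI conjI) auto
    qed (use fixed' I hole in \<open>auto simp: I_def fixed_regs_def\<close>)
    show "wp (block [ISub 3 3 2, IAdd 11 3 10, sift]) s'
        (\<lambda>t s''. \<exists>q'. I q' s'' \<and> 1 + t + q' \<le> q)"
      using fixed' i by (simp add: fixed_regs_def) (rule wp_mono [OF sift], auto)
  next
    fix q t :: nat and s'
    assume "I q s'" "\<not> holds (ILess 10 3) s'" "t + q \<le> n * (6 + 20 * e) + 1"
    then show "Q (2 + t) s'"
      by (intro Q) (auto simp: I_def fixed_regs_def)
  qed
  then show ?thesis
    using fixed by (simp add: heapify_def fixed_regs_def)
qed

definition extract_max :: prog where
  "extract_max = block
     [ISub 6 6 2, Load 5 1, IAdd 4 1 6, Load 6 4, Store 1 6, Store 4 5, ISet 11 0, sift]"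

text \<open>Cells from the heap size on are final: each dominates everything to its left. The
  extracted root extends this tail by one cell, and sifting only permutes cells before it.\<close>

lemma wp_extract:
  assumes fixed: "fixed_regs s n \<mu> m c" and e: "n < 2 ^ e" and N: "ireg s 6 = n"
    and heap: "heap_from (arr s (2 * n)) n 0"
    and Q: "\<And>t s'. fixed_regs s' n \<mu> m c \<Longrightarrow> (\<forall>j<n. \<forall>i\<le>j. arr s' (2 * n) i \<le> arr s' (2 * n) j) \<Longrightarrow>
      permuted n s s' \<Longrightarrow> t \<le> 1 + n * (11 + 20 * e) \<Longrightarrow> Q t s'"
  shows "wp (While (ILess 10 6) extract_max) s Q"
proof -
  let ?h = "\<lambda>s. arr s (2 * n)"
  let ?I = "\<lambda>q s'. fixed_regs s' n \<mu> m c \<and> ireg s' 6 \<le> n \<and> q = ireg s' 6 * (11 + 20 * e) \<and>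
     heap_from (?h s') (ireg s' 6) 0 \<and> permuted n s s' \<and>
     (\<forall>j<n. ireg s' 6 \<le> j \<longrightarrow> (\<forall>i\<le>j. ?h s' i \<le> ?h s' j))"
  have start: "?I (n * (11 + 20 * e)) s"
    using fixed N heap by (auto simp: permuted_refl)
  have step: "wp extract_max s' (\<lambda>t s''. \<exists>q'. ?I q' s'' \<and> 1 + t + q' \<le> q)"
    if I: "?I q s'" and "holds (ILess 10 6) s'" for q s'
  proof -
    obtain N where N: "ireg s' 6 = Suc N"
      using \<open>holds (ILess 10 6) s'\<close> I by (cases "ireg s' 6") (auto simp: fixed_regs_def)
    have fixed': "fixed_regs s' n \<mu> m c" and heap: "heap_from (?h s') (Suc N) 0"
      and perm: "permuted n s s'" and "N < n" and q: "q = Suc N * (11 + 20 * e)"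
      and sorted: "\<And>i j. j < n \<Longrightarrow> Suc N \<le> j \<Longrightarrow> i \<le> j \<Longrightarrow> ?h s' i \<le> ?h s' j"
      using I N by auto
    define h where "h = (?h s')(0 := ?h s' N, N := ?h s' 0)"
    define s1 where "s1 = s'\<lparr>rreg := (rreg s')(5 := mem s' (2 * n), 6 := mem s' (2 * n + N)),
      mem := (mem s')(2 * n := mem s' (2 * n + N), 2 * n + N := mem s' (2 * n)),
      ireg := (ireg s')(6 := N, 4 := 2 * n + N, 11 := 0)\<rparr>"
    have h1: "?h s1 = h"
      by (auto simp: s1_def h_def arr_def fun_eq_iff)
    have hole: "heap_hole h N 0 0"
      using heap unfolding heap_hole_def heap_from_def h_def by auto
    have max: "h i \<le> h N" if "i \<le> N" for i
      using heap_max [OF heap, of i] heap_max [OF heap, of N] heap_max [OF heap, of 0] that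
      unfolding h_def by auto
    have tail: "h i \<le> h j" if "j < n" "Suc N \<le> j" "i \<le> j" for i j
      using sorted [OF that] sorted [OF that(1,2), of N] sorted [OF that(1,2), of 0] that
      unfolding h_def by auto
    have sift: "wp sift s1 (\<lambda>t s''. \<exists>q'. ?I q' s'' \<and> 8 + t + q' \<le> q)"
    proof (rule wp_sift [where n = n and \<mu> = \<mu> and m = m and c = c and k = 0 and e = e])
      show "ireg s1 6 < (ireg s1 11 + 1) * 2 ^ e"
        using e \<open>N < n\<close> by (simp add: s1_def)
    next
      fix t :: nat and s''
      assume s'': "fixed_regs s'' n \<mu> m c" "ireg s'' 6 = ireg s1 6" "ireg s'' 3 = ireg s1 3"
        "heap_from (?h s'') (ireg s1 6) 0"
        and ex: "\<exists>\<pi>. \<pi> permutes {..<ireg s1 6} \<and> ?h s'' = ?h s1 \<circ> \<pi>"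
        and mem: "\<forall>i<2 * n. mem s'' i = mem s1 i" and "t \<le> 3 + 20 * e"
      have N': "ireg s1 6 = N" by (simp add: s1_def)
      obtain \<pi> where \<pi>: "\<pi> permutes {..<N}" "?h s'' = h \<circ> \<pi>"
        using ex N' h1 by auto
      have "\<exists>\<pi>. \<pi> permutes {..<Suc N} \<and> h = ?h s' \<circ> \<pi>"
        unfolding h_def by (rule swap_permutes) auto
      moreover have "\<exists>\<pi>. \<pi> permutes {..<Suc N} \<and> ?h s'' = h \<circ> \<pi>"
        using \<pi> permutes_subset [OF \<pi>(1), of "{..<Suc N}"] by auto
      ultimately have "\<exists>\<pi>. \<pi> permutes {..<Suc N} \<and> ?h s'' = ?h s' \<circ> \<pi>"
        by (rule permuted_trans)
      then have perm'': "permuted n s s''"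
        using perm mem \<open>N < n\<close> by (intro permuted_extend [of n s s' s'' "Suc N"]) (auto simp: s1_def)
      \<comment> \<open>The permutation fixes \<open>j\<close> and never carries \<open>i\<close>
        beyond it, so the bounds from before sifting carry over.\<close>
      have "?h s'' i \<le> ?h s'' j" if "j < n" "N \<le> j" "i \<le> j" for i j
      proof -
        have "\<pi> j = j" using \<pi>(1) that by (auto simp: permutes_def)
        moreover have "\<pi> i \<le> j"
          using that permutes_in_image [OF \<pi>(1), of i] permutes_not_in [OF \<pi>(1), of i]
          by (cases "i < N") auto
        ultimately show ?thesis
          using max [of "\<pi> i"] tail [of j "\<pi> i"] that \<pi>(2) by (cases "j = N") auto
      qed
      then have "?I (N * (11 + 20 * e)) s''"
        using s'' perm'' \<open>N < n\<close> N' by auto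
      then show "\<exists>q'. ?I q' s'' \<and> 8 + t + q' \<le> q"
        using q \<open>t \<le> 3 + 20 * e\<close> by (intro exI [of _ "N * (11 + 20 * e)"] conjI) auto
    next
      show "fixed_regs s1 n \<mu> m c" using fixed' by (simp add: s1_def fixed_regs_def)
      show "heap_hole (?h s1) (ireg s1 6) 0 (ireg s1 11)" using hole h1 by (simp add: s1_def)
    qed simp
    have "wp extract_max s' R
        \<longleftrightarrow> wp sift s1 (\<lambda>t. R (Suc (Suc (Suc (Suc (Suc (Suc (Suc t))))))))" for R
      using fixed' N by (simp add: extract_max_def fixed_regs_def s1_def)
    then show ?thesis
      by (simp only:) (rule wp_mono [OF sift], auto)
  qed
  show ?thesis
  proof (rule wp_While [where I = ?I, OF start step])
    show "Q t s'" if "?I q s'" "\<not> holds (ILess 10 6) s'" "t + q \<le> n * (11 + 20 * e) + 1" for q t s'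
      using that by (intro Q) (auto simp: fixed_regs_def)
  qed
qed


section \<open>Inverting the sum of ramps\<close>

text \<open>The breakpoints below \<open>L\<close> are \<open>h i\<close> for \<open>i < q\<close> and \<open>h i + \<mu>\<close> for \<open>i < p\<close>.\<close>

definition segment :: "nat \<Rightarrow> real \<Rightarrow> (nat \<Rightarrow> real) \<Rightarrow> nat \<Rightarrow> nat \<Rightarrow> real \<Rightarrow> bool" where
  "segment n \<mu> h p q L \<longleftrightarrow> p \<le> q \<and> q \<le> n \<and>
     (\<forall>i<q. h i \<le> L) \<and> (\<forall>i. q \<le> i \<and> i < n \<longrightarrow> L \<le> h i) \<and>
     (\<forall>i<p. h i + \<mu> \<le> L) \<and> (\<forall>i. p \<le> i \<and> i < n \<longrightarrow> L \<le> h i + \<mu>)"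

text \<open>On a segment the first \<open>p\<close> ramps are saturated, those from \<open>p\<close>
  to \<open>q\<close> are active and the rest vanish, so the sum is affine with slope
  \<open>q - p\<close>; this is its constant term.\<close>

definition intercept :: "real \<Rightarrow> (nat \<Rightarrow> real) \<Rightarrow> nat \<Rightarrow> nat \<Rightarrow> real" where
  "intercept \<mu> h p q = \<mu> * real p - (\<Sum>i=p..<q. h i)"

lemma ramp_sum_segment:
  assumes seg: "segment n \<mu> h p q L" and "\<mu> > 0"
  shows "(\<Sum>i<n. ramp \<mu> (L - h i)) = intercept \<mu> h p q + (real q - real p) * L"
proof -
  have pq: "p \<le> q" "q \<le> n" using seg by (auto simp: segment_def)
  have "(\<Sum>i<n. ramp \<mu> (L - h i))
      = (\<Sum>i=0..<p. ramp \<mu> (L - h i)) + (\<Sum>i=p..<q. ramp \<mu> (L - h i)) + (\<Sum>i=q..<n. ramp \<mu> (L - h i))"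
    using pq by (simp add: sum.atLeastLessThan_concat lessThan_atLeast0)
  moreover have "(\<Sum>i=0..<p. ramp \<mu> (L - h i)) = (\<Sum>i=0..<p. \<mu>)"
    using seg \<open>\<mu> > 0\<close> by (intro sum.cong) (auto simp: segment_def ramp_def min_def max_def)
  moreover have "(\<Sum>i=p..<q. ramp \<mu> (L - h i)) = (\<Sum>i=p..<q. L - h i)"
    using seg \<open>\<mu> > 0\<close> pq by (intro sum.cong) (auto simp: segment_def ramp_def min_def max_def algebra_simps)
  moreover have "(\<Sum>i=q..<n. ramp \<mu> (L - h i)) = 0"
    using seg \<open>\<mu> > 0\<close> by (intro sum.neutral) (auto simp: segment_def ramp_def min_def max_def)
  ultimately show ?thesis
    using pq by (simp add: intercept_def sum_subtractf of_nat_diff mult.commute)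
qed

text \<open>The sum is affine from \<open>L\<close> to \<open>L'\<close> and crosses
  \<open>T\<close> there. Strictness at \<open>L\<close> rules out slope 0, so the division is
  safe.\<close>

lemma segment_solve:
  assumes seg: "segment n \<mu> h p q L" "segment n \<mu> h p q L'" and "L \<le> L'" "\<mu> > 0"
    and below: "intercept \<mu> h p q + (real q - real p) * L < T"
    and above: "T \<le> intercept \<mu> h p q + (real q - real p) * L'"
  shows "real q - real p \<noteq> 0 \<and>
    (\<Sum>i<n. ramp \<mu> ((T - intercept \<mu> h p q) / (real q - real p) - h i)) = T"
proof -
  let ?D = "real q - real p" and ?K = "intercept \<mu> h p q"
  have "p \<le> q" using seg(1) by (auto simp: segment_def)
  moreover have "?D \<noteq> 0"
  proof
    assume "?D = 0"
    then show False using below above by simp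
  qed
  ultimately have D: "?D > 0" by simp
  let ?l = "(T - ?K) / ?D"
  have "L \<le> ?l" "?l \<le> L'"
    using below above D by (simp_all add: field_simps)
  then have "segment n \<mu> h p q ?l"
    using seg unfolding segment_def by (meson order_trans)
  from ramp_sum_segment [OF this \<open>\<mu> > 0\<close>] D show ?thesis by simp
qed

text \<open>The next breakpoint ends the old segment and starts the new one. Since it belongs to
  both, the two affine formulas agree there.\<close>

lemma segment_advance_q:
  assumes sorted: "\<And>i j. i \<le> j \<Longrightarrow> j < n \<Longrightarrow> h i \<le> h j"
    and seg: "segment n \<mu> h p q L" and "q < n" "h q \<le> h p + \<mu>" "\<mu> > 0"
  shows "segment n \<mu> h p q (h q)" "segment n \<mu> h p (Suc q) (h q)" "L \<le> h q"
    "intercept \<mu> h p (Suc q) = intercept \<mu> h p q - h q"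
proof -
  have pq: "p \<le> q" and L: "L \<le> h q" using seg \<open>q < n\<close> by (auto simp: segment_def)
  have 1: "h i \<le> h q" if "i \<le> q" for i using sorted [OF that \<open>q < n\<close>] .
  have 2: "h q \<le> h i" if "q \<le> i" "i < n" for i using sorted [OF that] .
  have 3: "h i + \<mu> \<le> h q" if "i < p" for i
    using seg L that unfolding segment_def by (meson order_trans)
  have 4: "h q \<le> h i + \<mu>" if "p \<le> i" "i < n" for i
    using sorted [OF that] \<open>h q \<le> h p + \<mu>\<close> by linarith
  show "segment n \<mu> h p q (h q)" "segment n \<mu> h p (Suc q) (h q)"
    using 1 2 3 4 pq \<open>q < n\<close> by (auto simp: segment_def)
  show "L \<le> h q" by (rule L)
  show "intercept \<mu> h p (Suc q) = intercept \<mu> h p q - h q"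
    using pq by (simp add: intercept_def)
qed

lemma segment_advance_p:
  assumes sorted: "\<And>i j. i \<le> j \<Longrightarrow> j < n \<Longrightarrow> h i \<le> h j"
    and seg: "segment n \<mu> h p q L" and "p < q" "q < n \<Longrightarrow> h p + \<mu> \<le> h q" "\<mu> > 0"
  shows "segment n \<mu> h p q (h p + \<mu>)" "segment n \<mu> h (Suc p) q (h p + \<mu>)" "L \<le> h p + \<mu>"
    "intercept \<mu> h (Suc p) q = intercept \<mu> h p q + (h p + \<mu>)"
proof -
  have qn: "q \<le> n" and L: "L \<le> h p + \<mu>" using seg \<open>p < q\<close> by (auto simp: segment_def)
  have 1: "h i \<le> h p + \<mu>" if "i < q" for i
    using seg L that unfolding segment_def by (meson order_trans)
  have 2: "h p + \<mu> \<le> h i" if "q \<le> i" "i < n" for i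
    using sorted [OF that] assms(4) that by fastforce
  have 3: "h i + \<mu> \<le> h p + \<mu>" if "i \<le> p" for i
    using sorted [OF that] \<open>p < q\<close> qn by simp
  have 4: "h p + \<mu> \<le> h i + \<mu>" if "p \<le> i" "i < n" for i
    using sorted [OF that] by simp
  show "segment n \<mu> h p q (h p + \<mu>)" "segment n \<mu> h (Suc p) q (h p + \<mu>)"
    using 1 2 3 4 \<open>p < q\<close> qn by (auto simp: segment_def)
  show "L \<le> h p + \<mu>" by (rule L)
  show "intercept \<mu> h (Suc p) q = intercept \<mu> h p q + (h p + \<mu>)"
    using \<open>p < q\<close> by (simp add: intercept_def sum.atLeast_Suc_lessThan algebra_simps)
qed

text \<open>Integer registers 8 and 9 hold \<open>p\<close> and \<open>q\<close>; real registers 8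
  and 9 hold intercept and slope, and 10 the sum at the current breakpoint. With
  \<open>q = n\<close> the candidate in real register 6 remains equal to the one in 5, so the
  comparison advances \<open>p\<close>.\<close>

definition sweep_step :: prog where
  "sweep_step = block [RAdd 11 8 1, RAdd 12 9 1, IAdd 4 1 8, Load 5 4, RAdd 5 5 0, RAdd 6 5 1,
     Cond (ILess 9 0) (block [IAdd 4 1 9, Load 6 4]) skip,
     Cond (RLess 6 5)
       (block [RSub 8 8 6, RAdd 9 9 2, IAdd 9 9 2])
       (block [RAdd 8 8 5, RSub 9 9 2, RAdd 6 5 1, IAdd 8 8 2]),
     RMul 7 9 6, RAdd 10 8 7]"

text \<open>Without positive labels the target is 0 and the loop is never entered. The initial
  intercept \<open>- h 0\<close> and slope 1 then make the quotient \<open>h 0\<close>, the least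
  shift, where all ramps vanish.\<close>

definition sweep :: prog where
  "sweep = block [ISet 8 0, ISet 9 0, RSet 8 0, RSet 9 0, RSet 10 0, Load 5 1, RSub 11 1 5,
     RSet 12 1, RMul 13 0 3, While (RLess 10 13) sweep_step, RSub 7 13 11, RDiv 14 7 12]"

lemma wp_sweep_step:
  assumes fixed: "fixed_regs s n \<mu> m c"
    and step_q: "\<And>t s'. fixed_regs s' n \<mu> m c \<Longrightarrow> mem s' = mem s \<Longrightarrow> rreg s' 13 = rreg s 13 \<Longrightarrow>
      rreg s' 11 = rreg s 8 \<Longrightarrow> rreg s' 12 = rreg s 9 \<Longrightarrow>
      ireg s 9 < n \<Longrightarrow> mem s (2 * n + ireg s 9) < mem s (2 * n + ireg s 8) + \<mu> \<Longrightarrow>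
      ireg s' 8 = ireg s 8 \<Longrightarrow> ireg s' 9 = Suc (ireg s 9) \<Longrightarrow>
      rreg s' 8 = rreg s 8 - mem s (2 * n + ireg s 9) \<Longrightarrow> rreg s' 9 = rreg s 9 + 1 \<Longrightarrow>
      rreg s' 10 = rreg s' 8 + rreg s' 9 * mem s (2 * n + ireg s 9) \<Longrightarrow> t \<le> 19 \<Longrightarrow> Q t s'"
    and step_p: "\<And>t s'. fixed_regs s' n \<mu> m c \<Longrightarrow> mem s' = mem s \<Longrightarrow> rreg s' 13 = rreg s 13 \<Longrightarrow>
      rreg s' 11 = rreg s 8 \<Longrightarrow> rreg s' 12 = rreg s 9 \<Longrightarrow>
      \<not> (ireg s 9 < n \<and> mem s (2 * n + ireg s 9) < mem s (2 * n + ireg s 8) + \<mu>) \<Longrightarrow>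
      ireg s' 8 = Suc (ireg s 8) \<Longrightarrow> ireg s' 9 = ireg s 9 \<Longrightarrow>
      rreg s' 8 = rreg s 8 + (mem s (2 * n + ireg s 8) + \<mu>) \<Longrightarrow> rreg s' 9 = rreg s 9 - 1 \<Longrightarrow>
      rreg s' 10 = rreg s' 8 + rreg s' 9 * (mem s (2 * n + ireg s 8) + \<mu>) \<Longrightarrow> t \<le> 19 \<Longrightarrow> Q t s'"
  shows "wp sweep_step s Q"
proof -
  note regs = fixed [unfolded fixed_regs_def]
  show ?thesis
  proof (cases "ireg s 9 < n")
    case less: True
    show ?thesis
    proof (cases "mem s (2 * n + ireg s 9) < mem s (2 * n + ireg s 8) + \<mu>")
      case True
      with less show ?thesis
        by (simp add: sweep_step_def regs; intro step_q) (simp_all add: fixed_regs_def regs)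
    next
      case False
      with less show ?thesis
        by (simp add: sweep_step_def regs; intro step_p) (simp_all add: fixed_regs_def regs)
    qed
  next
    case False
    then show ?thesis
      by (simp add: sweep_step_def regs; intro step_p) (simp_all add: fixed_regs_def regs)
  qed
qed

lemma wp_sweep:
  assumes fixed: "fixed_regs s n \<mu> m c" and "\<mu> > 0" "0 \<le> m" "m \<le> real n"
    and sorted: "\<forall>j<n. \<forall>i\<le>j. arr s (2 * n) i \<le> arr s (2 * n) j"
    and Q: "\<And>t s'. fixed_regs s' n \<mu> m c \<Longrightarrow> mem s' = mem s \<Longrightarrow>
      (\<Sum>i<n. ramp \<mu> (rreg s' 14 - arr s (2 * n) i)) = \<mu> * m \<Longrightarrow> t \<le> 12 + 40 * n \<Longrightarrow> Q t s'"
  shows "wp sweep s Q"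
proof -
  let ?h = "arr s (2 * n)" and ?T = "\<mu> * m"
  have sorted': "?h i \<le> ?h j" if "i \<le> j" "j < n" for i j
    using sorted that by blast
  \<comment> \<open>Registers 11 and 12 remember the segment before the last step. The last conjunct
    says that once the target is reached, the root lies on that segment.\<close>
  define J where "J p q s' \<longleftrightarrow> fixed_regs s' n \<mu> m c \<and> mem s' = mem s \<and> rreg s' 13 = ?T \<and>
     ireg s' 8 = p \<and> ireg s' 9 = q \<and> rreg s' 8 = intercept \<mu> ?h p q \<and> rreg s' 9 = real q - real p \<and>
     (\<exists>L. segment n \<mu> ?h p q L \<and> rreg s' 10 = intercept \<mu> ?h p q + (real q - real p) * L) \<and>
     (?T \<le> rreg s' 10 \<longrightarrow> rreg s' 12 \<noteq> 0 \<and>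
       (\<Sum>i<n. ramp \<mu> ((?T - rreg s' 11) / rreg s' 12 - ?h i)) = ?T)" for p q s'
  define I where "I k s' \<longleftrightarrow> (\<exists>p q. J p q s' \<and> k = ((n - p) + (n - q)) * 20)" for k s'
  let ?s = "s\<lparr>ireg := (ireg s)(8 := 0, 9 := 0),
    rreg := (rreg s)(8 := 0, 9 := 0, 10 := 0, 5 := ?h 0, 11 := - ?h 0, 12 := 1, 13 := ?T)\<rparr>"
  have loop: "wp (While (RLess 10 13) sweep_step) ?s
     (\<lambda>t s'. fixed_regs s' n \<mu> m c \<and> mem s' = mem s \<and> rreg s' 13 = ?T \<and> rreg s' 12 \<noteq> 0 \<and>
       (\<Sum>i<n. ramp \<mu> ((?T - rreg s' 11) / rreg s' 12 - ?h i)) = ?T \<and> t \<le> 1 + 40 * n)"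
  proof (rule wp_While [where I = I and k = "40 * n"])
    have seg: "segment n \<mu> ?h 0 0 (?h 0)"
      using sorted' \<open>\<mu> > 0\<close> by (fastforce simp: segment_def)
    moreover have "(\<Sum>i<n. ramp \<mu> (?h 0 - ?h i)) = 0"
      using ramp_sum_segment [OF seg \<open>\<mu> > 0\<close>] by (simp add: intercept_def)
    moreover have "?T \<le> 0 \<Longrightarrow> ?T = 0"
      using \<open>\<mu> > 0\<close> \<open>0 \<le> m\<close> by (simp add: mult_le_0_iff)
    ultimately have "J 0 0 ?s"
      using fixed by (auto simp: J_def fixed_regs_def intercept_def)
    then show "I (40 * n) ?s" unfolding I_def by (intro exI conjI) auto
  next
    fix k s'
    assume "I k s'" and test: "holds (RLess 10 13) s'"
    then obtain p q where J: "J p q s'" and k: "k = ((n - p) + (n - q)) * 20"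
      unfolding I_def by blast
    then obtain L where L: "segment n \<mu> ?h p q L" "rreg s' 10 = intercept \<mu> ?h p q + (real q - real p) * L"
      unfolding J_def by blast
    have below: "intercept \<mu> ?h p q + (real q - real p) * L < ?T"
      using test J L by (simp add: J_def)
    have pq: "p \<le> q" "q \<le> n" using L by (auto simp: segment_def)
    \<comment> \<open>Past all breakpoints the sum would be \<open>\<mu> * n\<close>, which is at
      least the target, and the loop would have stopped.\<close>
    have "p < n"
    proof (rule ccontr)
      assume "\<not> p < n"
      then have "p = n" "q = n" using pq by auto
      then show False using below \<open>\<mu> > 0\<close> \<open>m \<le> real n\<close> by (simp add: intercept_def mult_less_cancel_left)
    qed
    have regs: "ireg s' 0 = n" "ireg s' (Suc 0) = 2 * n" "ireg s' 2 = 1" "rreg s' 0 = \<mu>"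
        "rreg s' (Suc 0) = 0" "rreg s' 2 = 1" "ireg s' 8 = p" "ireg s' 9 = q"
        "rreg s' 8 = intercept \<mu> ?h p q" "rreg s' 9 = real q - real p" "mem s' = mem s"
      using J by (auto simp: J_def fixed_regs_def)
    have h: "mem s (2 * n + i) = ?h i" for i by (simp add: arr_def)
    \<comment> \<open>Old and new formula agree at the common breakpoint \<open>L'\<close>, so the
      value computed with the new counters also tests whether the old segment crosses the
      target.\<close>
    have J': "J p' q' s''"
      if s'': "fixed_regs s'' n \<mu> m c" "mem s'' = mem s'" "rreg s'' 13 = rreg s' 13"
          "rreg s'' 11 = rreg s' 8" "rreg s'' 12 = rreg s' 9"
          "ireg s'' 8 = p'" "ireg s'' 9 = q'" "rreg s'' 8 = intercept \<mu> ?h p' q'"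
          "rreg s'' 9 = real q' - real p'" "rreg s'' 10 = rreg s'' 8 + rreg s'' 9 * L'"
        and seg': "segment n \<mu> ?h p q L'" "segment n \<mu> ?h p' q' L'" "L \<le> L'"
      for p' q' s'' L'
    proof -
      have "intercept \<mu> ?h p' q' + (real q' - real p') * L'
          = intercept \<mu> ?h p q + (real q - real p) * L'"
        using ramp_sum_segment [OF seg'(1) \<open>\<mu> > 0\<close>] ramp_sum_segment [OF seg'(2) \<open>\<mu> > 0\<close>] by simp
      then show ?thesis
        using segment_solve [OF L(1) seg'(1,3) \<open>\<mu> > 0\<close> below] s'' seg'(2) regs J
        unfolding J_def by auto
    qed
    show "wp sweep_step s' (\<lambda>t s''. \<exists>k'. I k' s'' \<and> 1 + t + k' \<le> k)"
    proof (rule wp_sweep_step [of s' n \<mu> m c], goal_cases)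
      case 1
      then show ?case using J by (simp add: J_def)
    next
      case (2 t s'')
      then have q: "q < n" "?h q \<le> ?h p + \<mu>" by (auto simp: regs h)
      note adv = segment_advance_q [OF sorted' L(1) q \<open>\<mu> > 0\<close>]
      have "J p (Suc q) s''"
        using 2 adv by (intro J' [of s'' p "Suc q" "?h q"]) (auto simp: regs h)
      then have "I (((n - p) + (n - Suc q)) * 20) s''" unfolding I_def by blast
      then show ?case
        using 2(13) k q(1) by (intro exI [of _ "((n - p) + (n - Suc q)) * 20"] conjI) auto
    next
      case (3 t s'')
      then have not_q: "\<not> (q < n \<and> ?h q < ?h p + \<mu>)" by (simp add: regs h)
      have "p < q"
      proof (rule ccontr)
        assume "\<not> p < q"
        then show False using not_q pq \<open>p < n\<close> \<open>\<mu> > 0\<close> by auto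
      qed
      have q: "q < n \<Longrightarrow> ?h p + \<mu> \<le> ?h q" using not_q by auto
      note adv = segment_advance_p [OF sorted' L(1) \<open>p < q\<close> q \<open>\<mu> > 0\<close>]
      have "J (Suc p) q s''"
        using 3 adv by (intro J' [of s'' "Suc p" q "?h p + \<mu>"]) (auto simp: regs h)
      then have "I (((n - Suc p) + (n - q)) * 20) s''" unfolding I_def by blast
      then show ?case
        using 3(12) k \<open>p < n\<close> by (intro exI [of _ "((n - Suc p) + (n - q)) * 20"] conjI) auto
    qed
  next
    fix k t :: nat and s'
    assume "I k s'" "\<not> holds (RLess 10 13) s'" "t + k \<le> 40 * n + 1"
    then show "fixed_regs s' n \<mu> m c \<and> mem s' = mem s \<and> rreg s' 13 = ?T \<and> rreg s' 12 \<noteq> 0 \<and>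
       (\<Sum>i<n. ramp \<mu> ((?T - rreg s' 11) / rreg s' 12 - ?h i)) = ?T \<and> t \<le> 1 + 40 * n"
      unfolding I_def by (auto simp: J_def not_less)
  qed
  have "wp sweep s Q \<longleftrightarrow> wp (While (RLess 10 13) sweep_step) ?s
     (\<lambda>t s'. rreg s' 12 \<noteq> 0 \<and> Q (Suc (Suc (9 + t)))
       (s'\<lparr>rreg := (rreg s')(7 := rreg s' 13 - rreg s' 11, 14 := (rreg s' 13 - rreg s' 11) / rreg s' 12)\<rparr>))"
    using fixed by (simp add: sweep_def fixed_regs_def arr_def eval_nat_numeral)
  also have "\<dots>"
    by (rule wp_mono [OF loop], intro conjI Q) (auto simp: fixed_regs_def)
  finally show ?thesis .
qed


section \<open>The complete program\<close>

definition count_pos :: prog where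
  "count_pos = While (ILess 3 0)
     (block [IAdd 4 0 3, Load 5 4, Cond (RLess 1 5) (RAdd 3 3 2) skip, IAdd 3 3 2])"

definition write_shift :: prog where
  "write_shift = While (ILess 3 0)
     (block [IAdd 4 0 3, Load 5 4, Load 6 3,
        Cond (RLess 1 5) (block [RAdd 6 6 4, RSub 6 6 0]) (RSub 6 1 6),
        IAdd 4 1 3, Store 4 6, IAdd 3 3 2])"

definition write_target :: prog where
  "write_target = While (ILess 3 0)
     (block [IAdd 4 0 3, Load 5 4, Load 6 3,
        Cond (RLess 1 5) (RAdd 7 15 1) (RAdd 7 16 1),
        RSub 5 6 0,
        Cond (RLess 7 6) (Cond (RLess 7 5) (RAdd 7 5 1) skip) (RAdd 7 6 1),
        Store 3 7, IAdd 3 3 2])"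

definition solve_sorted :: prog where
  "solve_sorted = block [sweep, RSub 15 14 4, RSub 16 1 14, ISet 3 0, write_target]"

definition sort_and_solve :: prog where
  "sort_and_solve = block [heapify, While (ILess 10 6) extract_max, solve_sorted]"

text \<open>Division by zero would get stuck; storing 0 instead agrees with \<open>1 / 0 = 0\<close>
  in the logic.\<close>

definition shift_and_solve :: prog where
  "shift_and_solve = block
     [Cond (RLess 1 3) (RDiv 4 2 3) (RSet 4 0), ISet 3 0, write_shift, sort_and_solve]"

definition prbep_prog :: prog where
  "prbep_prog = block [ISet 2 1, IAdd 1 0 0, RSet 2 1, count_pos, shift_and_solve]"

context prbep_problem
begin

lemma pos_count_Suc: "pos_count (Suc i) y = pos_count i y + of_bool (y $ i = 1)"
proof -
  have "{j. j < Suc i \<and> y $ j = 1} = {j. j < i \<and> y $ j = 1} \<union> (if y $ i = 1 then {i} else {})"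
    by (auto simp: less_Suc_eq)
  then show ?thesis by (auto simp: pos_count_def)
qed

text \<open>The machine only tests strict inequality, so the programs recognize positive labels by
  their sign.\<close>

lemma y_pos_iff: "i < n \<Longrightarrow> 0 < y $ i \<longleftrightarrow> y $ i = 1"
  using y_cases [of i] by auto

lemma wp_count_pos:
  assumes fixed: "fixed_regs s n \<mu> 0 c" and "ireg s 3 = 0" and labels: "\<And>i. i < n \<Longrightarrow> mem s (n + i) = y $ i"
    and Q: "\<And>t s'. fixed_regs s' n \<mu> (real (pos_count n y)) c \<Longrightarrow> mem s' = mem s \<Longrightarrow>
      t \<le> 1 + 10 * n \<Longrightarrow> Q t s'"
  shows "wp count_pos s Q"
  unfolding count_pos_def
proof (rule wp_While [where k = "10 * n" and I = "\<lambda>k s'. ireg s' 3 \<le> n \<and> k = 10 * (n - ireg s' 3) \<and>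
      fixed_regs s' n \<mu> (real (pos_count (ireg s' 3) y)) c \<and> mem s' = mem s"], goal_cases)
  case 1
  then show ?case using fixed \<open>ireg s 3 = 0\<close> by (simp add: pos_count_def)
next
  case (2 k s')
  then have i: "ireg s' 3 < n" by (auto simp: fixed_regs_def)
  show ?case
    using 2 i labels [OF i] y_pos_iff [OF i] y_cases [OF i]
    by (cases "y $ ireg s' 3 = 1") (auto simp: fixed_regs_def pos_count_Suc)
next
  case (3 k t s')
  then show ?case by (intro Q) (auto simp: fixed_regs_def)
qed

lemma wp_write_shift:
  assumes fixed: "fixed_regs s n \<mu> (real (pos_count n y)) (1 / real (pos_count n y))" and "ireg s 3 = 0"
    and labels: "\<And>i. i < n \<Longrightarrow> mem s (n + i) = y $ i" and a: "\<And>i. i < n \<Longrightarrow> mem s i = a i"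
    and Q: "\<And>t s'. fixed_regs s' n \<mu> (real (pos_count n y)) (1 / real (pos_count n y)) \<Longrightarrow>
      (\<forall>i<2 * n. mem s' i = mem s i) \<Longrightarrow> (\<forall>i<n. arr s' (2 * n) i = shift a i) \<Longrightarrow>
      t \<le> 1 + 20 * n \<Longrightarrow> Q t s'"
  shows "wp write_shift s Q"
  unfolding write_shift_def
proof (rule wp_While [where k = "20 * n" and I = "\<lambda>k s'. ireg s' 3 \<le> n \<and> k = 20 * (n - ireg s' 3) \<and>
      fixed_regs s' n \<mu> (real (pos_count n y)) (1 / real (pos_count n y)) \<and>
      (\<forall>i<2 * n. mem s' i = mem s i) \<and> (\<forall>i<ireg s' 3. mem s' (2 * n + i) = shift a i)"], goal_cases)
  case 1
  then show ?case using fixed \<open>ireg s 3 = 0\<close> by simp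
next
  case (2 k s')
  then have i: "ireg s' 3 < n" by (auto simp: fixed_regs_def)
  then have m: "mem s' (n + ireg s' 3) = y $ ireg s' 3" "mem s' (ireg s' 3) = a (ireg s' 3)"
    using 2 labels [OF i] a [OF i] by auto
  show ?case
    using 2 i m y_pos_iff [OF i] y_cases [OF i]
    by (cases "y $ ireg s' 3 = 1") (auto simp: fixed_regs_def shift_def less_Suc_eq)
next
  case (3 k t s')
  then show ?case by (intro Q) (auto simp: fixed_regs_def arr_def)
qed

text \<open>The coefficients are overwritten in place. The invariant therefore keeps the input only
  from the current index on, which includes the labels.\<close>

lemma wp_write_target:
  assumes fixed: "fixed_regs s n \<mu> m c" and "ireg s 3 = 0"
    and \<nu>: "rreg s 15 = \<nu> - 1 / real (pos_count n y)" "rreg s 16 = - \<nu>"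
    and labels: "\<And>i. i < n \<Longrightarrow> mem s (n + i) = y $ i" and a: "\<And>i. i < n \<Longrightarrow> mem s i = a i"
    and Q: "\<And>t s'. (\<forall>i<n. mem s' i = clipped_target a \<nu> i) \<Longrightarrow> t \<le> 1 + 20 * n \<Longrightarrow> Q t s'"
  shows "wp write_target s Q"
  unfolding write_target_def
proof (rule wp_While [where k = "20 * n" and I = "\<lambda>k s'. ireg s' 3 \<le> n \<and> k = 20 * (n - ireg s' 3) \<and>
      fixed_regs s' n \<mu> m c \<and> rreg s' 15 = \<nu> - 1 / real (pos_count n y) \<and> rreg s' 16 = - \<nu> \<and>
      (\<forall>i. ireg s' 3 \<le> i \<and> i < 2 * n \<longrightarrow> mem s' i = mem s i) \<and>
      (\<forall>i<ireg s' 3. mem s' i = clipped_target a \<nu> i)"], goal_cases)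
  case 1
  then show ?case using fixed \<open>ireg s 3 = 0\<close> \<nu> by simp
next
  case (2 k s')
  define i where "i = ireg s' 3"
  have i: "i < n" using 2 by (auto simp: fixed_regs_def i_def)
  then have m: "mem s' (n + i) = y $ i" "mem s' i = a i"
    using 2 labels [OF i] a [OF i] by (auto simp: i_def)
  have b: "bonus i = (if y $ i = 1 then 1 / real (pos_count n y) else 0)"
    by (simp add: bonus_def)
  define t where "t = \<nu> * y $ i - bonus i"
  have t: "t = (if 0 < y $ i then \<nu> - 1 / real (pos_count n y) else - \<nu>)"
    using y_cases [OF i] by (auto simp: t_def b)
  have c: "clipped_target a \<nu> i = (if t < a i then if t < a i - \<mu> then a i - \<mu> else t else a i)"
    using mu by (auto simp: clipped_target_def t_def)
  show ?case
    using 2 i m unfolding i_def [symmetric]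
    by (cases "0 < y $ i"; cases "t < a i"; cases "t < a i - \<mu>")
      (auto simp: fixed_regs_def i_def [symmetric] less_Suc_eq c t)
next
  case (3 k t s')
  then show ?case by (intro Q) (auto simp: fixed_regs_def)
qed

lemma wp_prbep_prog:
  assumes e: "n < 2 ^ e"
  shows "wp prbep_prog (input_state n \<mu> (coeff_a n y w x) y)
     (\<lambda>t s. t \<le> 100 + n * (150 + 40 * e) \<and> optimal n \<mu> prbep y w x (output_vec n s) \<and>
        in_box n (coeff_a n y w x) \<mu> (output_vec n s))"
proof -
  let ?a = "coeff_a n y w x" and ?m = "real (pos_count n y)"
  let ?c = "1 / ?m"
  have m_le: "?m \<le> real n"
    using card_mono [of "{..<n}" "{i. i < n \<and> y $ i = 1}"] by (auto simp: pos_count_def)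
  let ?s0 = "input_state n \<mu> ?a y"
  have labels: "mem ?s0 (n + i) = y $ i" and a: "mem ?s0 i = ?a i" if "i < n" for i
    using that by (simp_all add: input_state_def)
  let ?s1 = "?s0\<lparr>ireg := (ireg ?s0)(2 := 1, 1 := 2 * n), rreg := (rreg ?s0)(2 := 1)\<rparr>"
  define final where "final t s \<longleftrightarrow> t \<le> 100 + n * (150 + 40 * e) \<and>
     optimal n \<mu> prbep y w x (output_vec n s) \<and> in_box n ?a \<mu> (output_vec n s)" for t s
  \<comment> \<open>The phases are composed from the last to the first; each claim takes the time
    \<open>t\<close> already spent together with a generous cap on it.\<close>
  have target: "wp write_target (s\<lparr>rreg := (rreg s)(15 := rreg s 14 - rreg s 4, 16 := - rreg s 14),
        ireg := (ireg s)(3 := 0)\<rparr>) (\<lambda>t'. final (t + t'))"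
    if s: "fixed_regs s n \<mu> ?m ?c" "\<forall>i<2 * n. mem s i = mem ?s0 i"
      "(\<Sum>i<n. ramp \<mu> (rreg s 14 - shift ?a i)) = \<mu> * ?m" "t \<le> 90 + n * (120 + 40 * e)" for s :: ram and t
  proof (rule wp_write_target [where \<nu> = "rreg s 14" and m = ?m and c = ?c and a = ?a])
    fix t' :: nat and s' :: ram
    assume s': "\<forall>i<n. mem s' i = clipped_target ?a (rreg s 14) i" "t' \<le> 1 + 20 * n"
    have "optimal n \<mu> prbep y w x (output_vec n s') \<and> in_box n ?a \<mu> (output_vec n s')"
      unfolding output_vec_def using s'(1) by (intro optimal_of_multiplier [OF s(3)]) auto
    then show "final (t + t') s'"
      using s' s(4) unfolding final_def by (auto simp: algebra_simps)
  qed (use s labels a in \<open>auto simp: fixed_regs_def\<close>)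
  have sweep: "wp solve_sorted s (\<lambda>t'. final (t + t'))"
    if s: "fixed_regs s n \<mu> ?m ?c" "\<forall>i<2 * n. mem s i = mem ?s0 i"
      "\<forall>j<n. \<forall>i\<le>j. arr s (2 * n) i \<le> arr s (2 * n) j"
      "\<And>f :: real \<Rightarrow> real. (\<Sum>i<n. f (arr s (2 * n) i)) = (\<Sum>i<n. f (shift ?a i))"
      "t \<le> 60 + n * (70 + 40 * e)" for s :: ram and t
    unfolding solve_sorted_def block.simps wp_Seq
  proof (rule wp_sweep [OF s(1) mu _ m_le s(3)])
    fix t' :: nat and s' :: ram
    assume s': "fixed_regs s' n \<mu> ?m ?c" "mem s' = mem s"
      "(\<Sum>i<n. ramp \<mu> (rreg s' 14 - arr s (2 * n) i)) = \<mu> * ?m" "t' \<le> 12 + 40 * n"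
    have "wp write_target (s'\<lparr>rreg := (rreg s')(15 := rreg s' 14 - rreg s' 4, 16 := - rreg s' 14),
        ireg := (ireg s')(3 := 0)\<rparr>) (\<lambda>ta. final (t + (t' + 3) + ta))"
      using s' s s(4) [of "\<lambda>u. ramp \<mu> (rreg s' 14 - u)"] by (intro target) (auto simp: algebra_simps)
    then show "wp (RSub 15 14 4) s' (\<lambda>ta s'. wp (RSub 16 1 14) s'
        (\<lambda>tb s'. wp (ISet 3 0) s' (\<lambda>tc s'. wp write_target s'
          (\<lambda>td. final (t + (t' + (ta + (tb + (tc + td)))))))))"
      using s'(1) by (simp add: fixed_regs_def numeral_3_eq_3 add.assoc)
  qed simp
  have sort: "wp sort_and_solve s (\<lambda>t'. final (t + t'))"
    if s: "fixed_regs s n \<mu> ?m ?c" "\<forall>i<2 * n. mem s i = mem ?s0 i"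
      "\<forall>i<n. arr s (2 * n) i = shift ?a i" "t \<le> 20 + n * 40" for s :: ram and t
    unfolding sort_and_solve_def block.simps wp_Seq
  proof (rule wp_heapify [OF s(1) e], rule wp_extract [OF _ e], assumption, assumption, assumption)
    fix t1 t2 :: nat and s1 s2 :: ram
    assume s1: "permuted n s s1" "t1 \<le> 3 + n * (6 + 20 * e)"
      and s2: "fixed_regs s2 n \<mu> ?m ?c" "\<forall>j<n. \<forall>i\<le>j. arr s2 (2 * n) i \<le> arr s2 (2 * n) j"
        "permuted n s1 s2" "t2 \<le> 1 + n * (11 + 20 * e)"
    have perm: "permuted n s s2"
      using s1(1) s2(3) by (intro permuted_extend [of n s s1 s2 n]) (auto simp: permuted_def)
    then obtain \<pi> where \<pi>: "\<pi> permutes {..<n}" "arr s2 (2 * n) = arr s (2 * n) \<circ> \<pi>"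
      by (auto simp: permuted_def)
    \<comment> \<open>The multiplier equation is symmetric in the shifts, so sorting them preserves
      its solutions.\<close>
    have "(\<Sum>i<n. f (arr s2 (2 * n) i)) = (\<Sum>i<n. f (shift ?a i))" for f :: "real \<Rightarrow> real"
    proof -
      have "(\<Sum>i<n. f (arr s2 (2 * n) i)) = (\<Sum>i<n. f (arr s (2 * n) i))"
        using sum.permute [OF \<pi>(1), of "\<lambda>i. f (arr s (2 * n) i)"] \<pi>(2) by (simp add: comp_def)
      then show ?thesis using s(3) by simp
    qed
    then have "wp solve_sorted s2 (\<lambda>t'. final (t + t1 + t2 + t'))"
      using s s1 s2 perm by (intro sweep) (auto simp: permuted_def algebra_simps)
    then show "wp solve_sorted s2 (\<lambda>t'. final (t + (t1 + (t2 + t'))))"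
      by (simp only: add.assoc)
  qed
  have shifted: "wp shift_and_solve s (\<lambda>t'. final (t + t'))"
    if s: "fixed_regs s n \<mu> ?m 0" "mem s = mem ?s0" "t \<le> 10 + n * 10" for s :: ram and t
  proof -
    let ?s = "s\<lparr>rreg := (rreg s)(4 := ?c), ireg := (ireg s)(3 := 0)\<rparr>"
    have "wp (Seq write_shift sort_and_solve) ?s (\<lambda>t'. final (t + (3 + t')))"
      unfolding wp_Seq
    proof (rule wp_write_shift [where a = ?a])
      fix t1 :: nat and s1 :: ram
      assume s1: "fixed_regs s1 n \<mu> ?m ?c" "\<forall>i<2 * n. mem s1 i = mem ?s i"
        "\<forall>i<n. arr s1 (2 * n) i = shift ?a i" "t1 \<le> 1 + 20 * n"
      have "wp sort_and_solve s1 (\<lambda>t'. final (t + (3 + t1) + t'))"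
        using s1 s by (intro sort) auto
      then show "wp sort_and_solve s1 (\<lambda>t'. final (t + (3 + (t1 + t'))))"
        by (simp only: add.assoc)
    qed (use s labels a in \<open>auto simp: fixed_regs_def\<close>)
    then show ?thesis
      using s(1) by (cases "pos_count n y = 0")
        (simp_all add: shift_and_solve_def fixed_regs_def numeral_3_eq_3)
  qed
  have start: "wp (Seq (ISet 2 1) (Seq (IAdd 1 0 0) (Seq (RSet 2 1) R))) ?s0 F
      \<longleftrightarrow> wp R ?s1 (\<lambda>t'. F (3 + t'))" for R F
    by (simp add: input_state_def numeral_3_eq_3 mult_2)
  have "wp (Seq count_pos shift_and_solve) ?s1 (\<lambda>t'. final (3 + t'))"
    unfolding wp_Seq
  proof (rule wp_count_pos)
    fix t1 :: nat and s1 :: ram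
    assume "fixed_regs s1 n \<mu> ?m 0" "mem s1 = mem ?s1" "t1 \<le> 1 + 10 * n"
    then have "wp shift_and_solve s1 (\<lambda>t'. final (3 + t1 + t'))"
      by (intro shifted) auto
    then show "wp shift_and_solve s1 (\<lambda>t'. final (3 + (t1 + t')))"
      by (simp only: add.assoc)
  qed (use labels in \<open>auto simp: fixed_regs_def input_state_def\<close>)
  then have "wp prbep_prog ?s0 final"
    by (simp only: prbep_prog_def block.simps start)
  then show ?thesis by (simp add: final_def [abs_def])
qed

end

section \<open>The running time in terms of \<open>n\<close>\<close>

definition log_bound :: "nat \<Rightarrow> nat" where
  "log_bound n = Suc (nat \<lfloor>log 2 (real n)\<rfloor>)"

lemma less_power_log_bound:
  assumes "n \<ge> 1"
  shows "n < 2 ^ log_bound n"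
proof -
  have "log 2 (real n) < real (log_bound n)"
    unfolding log_bound_def using assms by (simp add: floor_less_iff) linarith
  then have "real n < 2 powr real (log_bound n)"
    using assms log_less_iff [of 2 "real n" "real (log_bound n)"] by simp
  then show ?thesis
    by (simp add: powr_realpow)
qed

text \<open>From \<open>n = 3\<close> on, \<open>ln n\<close> is at least 1 and absorbs the
  constants. With \<open>1 / ln 2\<close> at most 2, the coefficients add up to 100 + 190 + 80,
  below 400.\<close>

lemma time_bound_bigo:
  "(\<lambda>n. real (100 + n * (150 + 40 * log_bound n))) \<in> O(\<lambda>n. real n * ln (real n))"
proof (rule bigoI [where c = 400], rule eventually_mono [OF eventually_ge_at_top [of 3]])
  fix n :: nat
  assume n: "3 \<le> n"
  have ln: "ln (real n) \<ge> 1"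
    using n exp_le by (subst ln_ge_iff) auto
  have "real (log_bound n) \<le> 1 + log 2 (real n)"
    using n by (simp add: log_bound_def)
  also have "log 2 (real n) = ln (real n) / ln 2" by (simp add: log_def)
  also have "\<dots> \<le> 2 * ln (real n)"
  proof -
    have "1 / 2 \<le> ln (2 :: real)" by (subst ln_ge_iff) (simp_all only: exp_half_le2 zero_less_numeral)
    then have "1 * ln (real n) \<le> (2 * ln 2) * ln (real n)"
      using ln by (intro mult_right_mono) auto
    then show ?thesis by (simp add: field_simps)
  qed
  finally have "100 + real n * (150 + 40 * real (log_bound n)) \<le> 100 + real n * (190 + 80 * ln (real n))"
    by (intro add_left_mono mult_left_mono) auto
  also have "\<dots> \<le> 100 * (real n * ln (real n)) + real n * (190 * ln (real n) + 80 * ln (real n))"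
  proof (intro add_mono mult_left_mono)
    have "1 * 1 \<le> real n * ln (real n)" using n ln by (intro mult_mono) auto
    then show "100 \<le> 100 * (real n * ln (real n))" by simp
  qed (use ln in auto)
  also have "\<dots> \<le> 400 * (real n * ln (real n))" using n ln by (simp add: algebra_simps)
  finally show "norm (real (100 + n * (150 + 40 * log_bound n))) \<le> 400 * norm (real n * ln (real n))"
    using n ln by simp
qed

theorem mainTheorem4:
  shows
    "(\<forall>n p (\<mu>::real) y w x \<Delta>.
        n \<ge> 1 \<longrightarrow> \<mu> > 0 \<longrightarrow> y \<in> labelings n \<longrightarrow> w \<in> carrier_vec p \<longrightarrow>
        (\<forall>i<n. x i \<in> carrier_vec p) \<longrightarrow> is_discrepancy n y \<Delta> \<longrightarrow>
        (\<exists>!\<theta>. optimal n \<mu> \<Delta> y w x \<theta> \<and> in_box n (coeff_a n y w x) \<mu> \<theta>) \<and>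
        (\<forall>\<theta>. optimal n \<mu> \<Delta> y w x \<theta> \<longrightarrow>
             optimal n \<mu> \<Delta> y w x (clip n (coeff_a n y w x) \<mu> \<theta>))) \<and>
     (\<exists>P (T :: nat \<Rightarrow> nat).
        (\<lambda>n. real (T n)) \<in> O(\<lambda>n. real n * ln (real n)) \<and>
        (\<forall>n p (\<mu>::real) y w x.
           n \<ge> 1 \<longrightarrow> \<mu> > 0 \<longrightarrow> y \<in> labelings n \<longrightarrow> w \<in> carrier_vec p \<longrightarrow>
           (\<forall>i<n. x i \<in> carrier_vec p) \<longrightarrow>
           (\<exists>t s. exec P (input_state n \<mu> (coeff_a n y w x) y) t s \<and> t \<le> T n \<and>
              optimal n \<mu> prbep y w x (output_vec n s) \<and>
              in_box n (coeff_a n y w x) \<mu> (output_vec n s))))"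
proof (intro conjI exI [of _ prbep_prog] exI [of _ "\<lambda>n. 100 + n * (150 + 40 * log_bound n)"]
    allI impI time_bound_bigo)
  fix n :: nat and \<mu> :: real and y w :: "real vec" and x :: "nat \<Rightarrow> real vec"
    and \<Delta> :: "real vec \<Rightarrow> real vec \<Rightarrow> ereal"
  assume "\<mu> > 0" "is_discrepancy n y \<Delta>"
  then interpret finite_discrepancy n \<mu> \<Delta> y
    by unfold_locales (auto simp: is_discrepancy_def)
  show "\<exists>!\<theta>. optimal n \<mu> \<Delta> y w x \<theta> \<and> in_box n (coeff_a n y w x) \<mu> \<theta>"
    by (rule ex1_optimal_in_box)
  show "optimal n \<mu> \<Delta> y w x (clip n (coeff_a n y w x) \<mu> \<theta>)" if "optimal n \<mu> \<Delta> y w x \<theta>" for \<theta>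
    using that by (rule optimal_clip)
next
  fix n :: nat and \<mu> :: real and y w :: "real vec" and x :: "nat \<Rightarrow> real vec"
  assume "n \<ge> 1" "\<mu> > 0" "y \<in> labelings n"
  then interpret prbep_problem n \<mu> y by unfold_locales
  show "\<exists>t s. exec prbep_prog (input_state n \<mu> (coeff_a n y w x) y) t s \<and>
      t \<le> 100 + n * (150 + 40 * log_bound n) \<and>
      optimal n \<mu> prbep y w x (output_vec n s) \<and> in_box n (coeff_a n y w x) \<mu> (output_vec n s)"
    using wp_prbep_prog [OF less_power_log_bound [OF \<open>n \<ge> 1\<close>], of w x]
    unfolding wp_def by blast
qed

end
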